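(* Let $X$ and $Y$ be nontrivial real Banach spaces. If $\mathrm{SNA}(X,Z)\cup \mathrm{Der}(X,Z)$ is dense in $\mathrm{Lip}_0(X,Z)$ for every renorming $Z$ of $Y$, then $Y$ has the Radon-Nikodým property.
   Context: A renorming of $Y$ is the vector space $Y$ equipped with a norm equivalent to the original one. For real Banach spaces $X,Z$, $\mathrm{Lip}_0(X,Z)$ denotes the space of Lipschitz maps $f:X\to Z$ with $f(0)=0$, equipped with the Lipschitz norm $\|f\| = \sup\{\|f(p)-f(q)\|/\|p-q\| : p,q\in X,\ p\neq q\}$; density is with respect to this norm. $S_X$ denotes the unit sphere of $X$. $f\in \mathrm{Lip}_0(X,Z)$ strongly attains its norm, written $f\in \mathrm{SNA}(X,Z)$, if there exist $p\neq q$ in $X$ with $\|f\| = \|f(p)-f(q)\|/\|p-q\|$. $f\in \mathrm{Lip}_0(X,Z)$ attains its maximal derivative, written $f\in \mathrm{Der}(X,Z)$, if there exist $x\in X$ and $e\in S_X$ such that the (two-sided, norm) limit $f'(x,e) := \lim_{t\to 0} \frac{f(x+te)-f(x)}{t}\in Z$ exists and $\|f'(x,e)\| = \|f\|$. A Banach space $Y$ has the Radon-Nikodým property (RNP) if for every finite measure space $(\Omega,\Sigma,\mu)$ and every $\mu$-continuous $Y$-valued measure $G:\Sigma\to Y$ of bounded variation there exists $g\in L_1(\mu,Y)$ with $G(E)=\int_E g\,d\mu$ for all $E\in\Sigma$. *)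

theory Defs
  imports "HOL-Analysis.Analysis"
begin

text \<open>
  A renorming of the Banach space \<open>'y\<close> is given by a function \<open>N\<close> that is an equivalent norm on
  the vector space \<open>'y\<close>.  All notions that refer to the target space \<open>Z = ('y, N)\<close> take \<open>N\<close> as a
  parameter and measure vectors of \<open>'y\<close> by \<open>N\<close> only; the domain \<open>'x\<close> carries its own norm.
\<close>

definition equivalent_norm :: "('y::real_normed_vector \<Rightarrow> real) \<Rightarrow> bool" where
  "equivalent_norm N \<longleftrightarrow>
     (\<forall>y. N y = 0 \<longleftrightarrow> y = 0) \<and>
     (\<forall>a y. N (a *\<^sub>R y) = \<bar>a\<bar> * N y) \<and>
     (\<forall>y z. N (y + z) \<le> N y + N z) \<and>
     (\<exists>c>0. \<exists>C>0. \<forall>y. c * norm y \<le> N y \<and> N y \<le> C * norm y)"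

definition Lip0 :: "('y \<Rightarrow> real) \<Rightarrow> ('x::real_normed_vector \<Rightarrow> 'y::real_normed_vector) set" where
  "Lip0 N = {f. f 0 = 0 \<and> (\<exists>L. \<forall>p q. N (f p - f q) \<le> L * norm (p - q))}"

text \<open>The supremum is meaningful for \<open>f \<in> Lip0 N\<close> on a nontrivial domain.\<close>

definition lip_norm ::
  "('y \<Rightarrow> real) \<Rightarrow> ('x::real_normed_vector \<Rightarrow> 'y::real_normed_vector) \<Rightarrow> real" where
  "lip_norm N f = Sup {N (f p - f q) / norm (p - q) | p q. p \<noteq> q}"

definition SNA :: "('y \<Rightarrow> real) \<Rightarrow> ('x::real_normed_vector \<Rightarrow> 'y::real_normed_vector) set" where
  "SNA N = {f \<in> Lip0 N. \<exists>p q. p \<noteq> q \<and> lip_norm N f = N (f p - f q) / norm (p - q)}"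

definition has_dir_derivative ::
  "('y \<Rightarrow> real) \<Rightarrow> ('x::real_normed_vector \<Rightarrow> 'y::real_normed_vector) \<Rightarrow> 'x \<Rightarrow> 'x \<Rightarrow> 'y \<Rightarrow> bool" where
  "has_dir_derivative N f x e z \<longleftrightarrow>
     ((\<lambda>t::real. N ((f (x + t *\<^sub>R e) - f x) /\<^sub>R t - z)) \<longlongrightarrow> 0) (at 0)"

definition Der :: "('y \<Rightarrow> real) \<Rightarrow> ('x::real_normed_vector \<Rightarrow> 'y::real_normed_vector) set" where
  "Der N = {f \<in> Lip0 N. \<exists>x e z. norm e = 1 \<and> has_dir_derivative N f x e z \<and> N z = lip_norm N f}"

definition dense_in_Lip0 ::
  "('y \<Rightarrow> real) \<Rightarrow> ('x::real_normed_vector \<Rightarrow> 'y::real_normed_vector) set \<Rightarrow> bool" where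
  "dense_in_Lip0 N A \<longleftrightarrow>
     A \<subseteq> Lip0 N \<and> (\<forall>f\<in>Lip0 N. \<forall>\<epsilon>>0. \<exists>g\<in>A. lip_norm N (\<lambda>x. f x - g x) < \<epsilon>)"

text \<open>
  The Bochner integral of the library is restricted to second-countable (i.e. separable) target
  spaces.  The following version has no such restriction: strong measurability is required
  instead of Borel measurability.  Since \<open>f\<close> agrees almost everywhere with a pointwise limit of
  simple functions, the integrands \<open>norm (f x - s i x)\<close> below agree almost everywhere with
  measurable functions, so that their \<open>nn_integral\<close> is the usual integral.
\<close>

definition strongly_measurable :: "'w measure \<Rightarrow> ('w \<Rightarrow> 'y::real_normed_vector) \<Rightarrow> bool" where
  "strongly_measurable M f \<longleftrightarrow>
     (\<exists>s. (\<forall>i::nat. simple_function M (s i)) \<and> (AE x in M. (\<lambda>i. s i x) \<longlonglongrightarrow> f x))"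

definition has_strong_bochner_integral ::
  "'w measure \<Rightarrow> ('w \<Rightarrow> 'y::real_normed_vector) \<Rightarrow> 'y \<Rightarrow> bool" where
  "has_strong_bochner_integral M f y \<longleftrightarrow>
     strongly_measurable M f \<and>
     (\<exists>s. (\<forall>i::nat. Bochner_Integration.simple_bochner_integrable M (s i)) \<and>
          (\<lambda>i. \<integral>\<^sup>+x. norm (f x - s i x) \<partial>M) \<longlonglongrightarrow> 0 \<and>
          (\<lambda>i. Bochner_Integration.simple_bochner_integral M (s i)) \<longlonglongrightarrow> y)"

definition vector_measure :: "'w measure \<Rightarrow> ('w set \<Rightarrow> 'y::real_normed_vector) \<Rightarrow> bool" where
  "vector_measure M G \<longleftrightarrow>
     (\<forall>A::nat \<Rightarrow> 'w set. range A \<subseteq> sets M \<longrightarrow> disjoint_family A \<longrightarrow>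
        (\<lambda>n. G (A n)) sums G (\<Union>n. A n))"

definition measure_continuous :: "'w measure \<Rightarrow> ('w set \<Rightarrow> 'y::real_normed_vector) \<Rightarrow> bool" where
  "measure_continuous M G \<longleftrightarrow>
     (\<forall>\<epsilon>>0. \<exists>\<delta>>0. \<forall>E\<in>sets M. measure M E < \<delta> \<longrightarrow> norm (G E) < \<epsilon>)"

definition bounded_variation :: "'w measure \<Rightarrow> ('w set \<Rightarrow> 'y::real_normed_vector) \<Rightarrow> bool" where
  "bounded_variation M G \<longleftrightarrow>
     (\<exists>B. \<forall>P. finite P \<and> P \<subseteq> sets M \<and> disjoint P \<and> \<Union>P = space M \<longrightarrow> (\<Sum>E\<in>P. norm (G E)) \<le> B)"

text \<open>
  HOL cannot quantify over types inside a formula, so the type \<open>'w\<close> of the points of the measure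
  spaces is a parameter.  The Radon-Nikodym property of \<open>'y\<close> is this statement for all types
  \<open>'w\<close>: it is expressed by a conclusion in which \<open>'w\<close> is a type variable that occurs nowhere else.
\<close>

definition radon_nikodym_property :: "'w itself \<Rightarrow> 'y::banach itself \<Rightarrow> bool" where
  "radon_nikodym_property TYPE('w) TYPE('y) \<longleftrightarrow>
     (\<forall>(M :: 'w measure) (G :: 'w set \<Rightarrow> 'y).
        finite_measure M \<and> vector_measure M G \<and> measure_continuous M G \<and> bounded_variation M G \<longrightarrow>
        (\<exists>g. (\<exists>y. has_strong_bochner_integral M g y) \<and>
             (\<forall>E\<in>sets M. has_strong_bochner_integral M (\<lambda>x. indicator E x *\<^sub>R g x) (G E))))"

end

theory Submission
  imports Defs
begin

text \<open>
  If the Radon-Nikodym property fails, a vector measure without density yields, by exhaustion, an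
  \<open>\<epsilon>\<close>-bush: sets that split repeatedly into finitely many pieces on each of which the average of the
  measure differs by at least \<open>\<epsilon>\<close> from the average on the whole.  Laying the pieces side by side on
  an interval turns the bush into a Lipschitz curve \<open>F\<close> whose difference quotients oscillate by
  \<open>\<epsilon>\<close> at every point.  Compose \<open>F\<close> with a norm-one functional on the domain.  A function \<open>g\<close> close
  to this composition cannot have a directional derivative of almost maximal norm.  To exclude
  strong norm attainment as well, add to the square of the norm a weighted sum of squares of
  countably many functionals that norm the difference quotients of \<open>F\<close>: equality in the triangle
  inequality makes these functionals proportional on the summands, so they are affine along \<open>g\<close> on a
  segment where \<open>g\<close> attains its norm, which bounds the oscillation of \<open>F\<close> there.
\<close>

section \<open>Norming functionals\<close>

text \<open>A strictly convex equivalent norm would make \<open>g\<close> itself affine on a segment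
  where it attains its norm, but not every Banach space has one. Countably many functionals suffice
  because they never have to norm values of \<open>g\<close>: the only vectors whose norm is
  recovered from them are differences of two difference quotients of \<open>F\<close>, and these lie
  in a continuous image of a second-countable space. The functionals are defined on the whole
  target, so their compositions with \<open>g\<close> make sense, and replacing \<open>g\<close> by
  \<open>f\<close> changes them by at most the \<open>N\<close>-error.

  This error is divided by the rate at which the functional \<open>\<xi>\<close> on the domain
  changes along the segment or direction in question; \<open>f\<close> is constant along the kernel
  of \<open>\<xi>\<close>. Almost maximal growth bounds the rate from below because \<open>F\<close>
  is Lipschitz, and this fixes the size of \<open>\<eta>\<close>. Outside \<open>[0, m]\<close> the
  curve is constant, so both cases also have to locate a point of \<open>[0, m]\<close>.\<close>

lemma norming_functional:
  fixes a :: "'a::real_normed_vector"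
  shows "\<exists>\<phi>. linear \<phi> \<and> (\<forall>y. \<bar>\<phi> y\<bar> \<le> norm y) \<and> \<phi> a = norm a"
proof -
  \<comment> \<open>Hahn-Banach with graphs as subspaces of the product. Single-valuedness is not
    demanded: it follows from \<open>t \<le> norm 0\<close> applied to differences.\<close>
  define \<S> where "\<S> = {S :: ('a \<times> real) set. subspace S \<and> (a, norm a) \<in> S \<and> (\<forall>(y, t) \<in> S. t \<le> norm y)}"
  have "span {(a, norm a)} \<in> \<S>"
  proof -
    have "c * norm a \<le> norm (c *\<^sub>R a)" for c
      by (simp add: mult_right_mono)
    then have "\<forall>(y, t) \<in> span {(a, norm a)}. t \<le> norm y"
      by (auto simp: span_singleton)
    then show ?thesis
      by (simp add: \<S>_def span_base)
  qed
  moreover have "\<Union>C \<in> \<S>" if "C \<noteq> {}" "subset.chain \<S> C" for C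
  proof -
    have C: "S \<in> \<S>" if "S \<in> C" for S
      using that \<open>subset.chain \<S> C\<close> by (auto simp: subset.chain_def)
    have cmp: "S \<subseteq> S' \<or> S' \<subseteq> S" if "S \<in> C" "S' \<in> C" for S S'
      using that \<open>subset.chain \<S> C\<close> by (auto simp: subset.chain_def)
    have "x + y \<in> \<Union>C" if xy: "x \<in> \<Union>C" "y \<in> \<Union>C" for x y
    proof -
      obtain S S' where S: "S \<in> C" "x \<in> S" "S' \<in> C" "y \<in> S'"
        using xy by blast
      then obtain R where "R \<in> C" "x \<in> R" "y \<in> R"
        using cmp[of S S'] by blast
      then have "x + y \<in> R" using C[of R] by (auto simp: \<S>_def subspace_add)
      then show ?thesis using \<open>R \<in> C\<close> by blast
    qed
    moreover have "c *\<^sub>R x \<in> \<Union>C" if "x \<in> \<Union>C" for c x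
      using that C unfolding \<S>_def by (blast intro: subspace_scale)
    moreover have "0 \<in> \<Union>C"
      using that(1) C by (auto simp: \<S>_def subspace_0)
    ultimately have "subspace (\<Union>C)" by (simp add: subspace_def)
    moreover have "(a, norm a) \<in> \<Union>C" using that(1) C by (auto simp: \<S>_def)
    moreover have "\<forall>(y, t) \<in> \<Union>C. t \<le> norm y" using C by (auto simp: \<S>_def)
    ultimately show ?thesis by (simp add: \<S>_def)
  qed
  ultimately obtain S where S: "S \<in> \<S>" and max: "\<And>X. X \<in> \<S> \<Longrightarrow> S \<subseteq> X \<Longrightarrow> X = S"
    using subset_Zorn_nonempty[of \<S>] by blast
  have sub: "subspace S" and aS: "(a, norm a) \<in> S" and le: "\<And>y t. (y, t) \<in> S \<Longrightarrow> t \<le> norm y"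
    using S by (auto simp: \<S>_def)
  have total: "\<exists>t. (y1, t) \<in> S" for y1
  proof -
    define Lo where "Lo = (\<lambda>(y, t). t - norm (y - y1)) ` S"
    \<comment> \<open>Any value between the lower bounds \<open>t - norm (y - y1)\<close> and the
      upper bounds \<open>norm (y + y1) - t\<close> extends the graph to \<open>y1\<close>;
      \<open>key\<close> says that these bounds do not cross.\<close>
    define s where "s = Sup Lo"
    have key: "t - norm (y - y1) \<le> norm (y' + y1) - t'" if "(y, t) \<in> S" "(y', t') \<in> S" for y t y' t'
    proof -
      have "(y + y', t + t') \<in> S" using subspace_add[OF sub that] by simp
      then have "t + t' \<le> norm (y + y')" by (rule le)
      also have "y + y' = (y - y1) + (y' + y1)" by simp
      also have "norm \<dots> \<le> norm (y - y1) + norm (y' + y1)" by (rule norm_triangle_ineq)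
      finally show ?thesis by simp
    qed
    have bdd: "bdd_above Lo"
      unfolding Lo_def using key aS by (intro bdd_aboveI[of _ "norm (a + y1) - norm a"]) auto
    have lower: "t - norm (y - y1) \<le> s" if "(y, t) \<in> S" for y t
      unfolding s_def using that bdd by (intro cSup_upper) (auto simp: Lo_def)
    have upper: "s \<le> norm (y + y1) - t" if "(y, t) \<in> S" for y t
      unfolding s_def using that key aS by (intro cSup_least) (auto simp: Lo_def)
    have "t + c * s \<le> norm (y + c *\<^sub>R y1)" if yt: "(y, t) \<in> S" for y t c
    proof -
      consider "c = 0" | "c > 0" | "c < 0" by linarith
      then show ?thesis
      proof cases
        case 1
        then show ?thesis using le[OF yt] by simp
      next
        case 2
        have "(inverse c *\<^sub>R y, inverse c * t) \<in> S" using subspace_scale[OF sub yt, of "inverse c"] by simp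
        from upper[OF this] have "inverse c * t + s \<le> norm (inverse c *\<^sub>R y + y1)" by simp
        then have "c * (inverse c * t + s) \<le> c * norm (inverse c *\<^sub>R y + y1)" using 2 by simp
        also have "\<dots> = norm (c *\<^sub>R (inverse c *\<^sub>R y + y1))" using 2 by simp
        also have "c *\<^sub>R (inverse c *\<^sub>R y + y1) = y + c *\<^sub>R y1" using 2 by (simp add: scaleR_add_right)
        finally show ?thesis using 2 by (simp add: distrib_left mult.assoc[symmetric])
      next
        case 3
        define d where "d = - c"
        have d: "d > 0" "c = - d" using 3 by (auto simp: d_def)
        have "(inverse d *\<^sub>R y, inverse d * t) \<in> S" using subspace_scale[OF sub yt, of "inverse d"] by simp
        from lower[OF this] have "inverse d * t - s \<le> norm (inverse d *\<^sub>R y - y1)" by simp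
        then have "d * (inverse d * t - s) \<le> d * norm (inverse d *\<^sub>R y - y1)" using d by simp
        also have "\<dots> = norm (d *\<^sub>R (inverse d *\<^sub>R y - y1))" using d by simp
        also have "d *\<^sub>R (inverse d *\<^sub>R y - y1) = y + c *\<^sub>R y1" using d by (simp add: scaleR_diff_right)
        finally show ?thesis using d by (simp add: right_diff_distrib mult.assoc[symmetric])
      qed
    qed
    note extend = this
    have "t \<le> norm y" if "(y, t) - c *\<^sub>R (y1, s) \<in> S" for y t c
      using extend[of "y - c *\<^sub>R y1" "t - c * s" c] that by simp
    moreover have "span (insert (y1, s) S) = {x. \<exists>c. x - c *\<^sub>R (y1, s) \<in> S}"
      unfolding span_insert span_eq_iff[THEN iffD2, OF sub] ..
    ultimately have "\<forall>(y, t) \<in> span (insert (y1, s) S). t \<le> norm y"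
      by blast
    moreover have "(a, norm a) \<in> span (insert (y1, s) S)"
      using aS by (auto intro: span_base)
    ultimately have "span (insert (y1, s) S) \<in> \<S>"
      by (auto simp: \<S>_def)
    then have "span (insert (y1, s) S) = S"
      by (rule max) (auto intro: span_base)
    then show ?thesis using span_base[of "(y1, s)" "insert (y1, s) S"] by auto
  qed
  have unique: "t = t'" if "(y, t) \<in> S" "(y, t') \<in> S" for y t t'
  proof -
    have "(0, t - t') \<in> S" "(0, t' - t) \<in> S"
      using subspace_diff[OF sub that] subspace_diff[OF sub that(2,1)] by auto
    then show ?thesis using le[of 0 "t - t'"] le[of 0 "t' - t"] by simp
  qed
  define \<phi> where "\<phi> y = (SOME t. (y, t) \<in> S)" for y
  have \<phi>: "(y, \<phi> y) \<in> S" for y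
    unfolding \<phi>_def using total by (rule someI_ex)
  have "linear \<phi>"
  proof (rule linearI)
    show "\<phi> (x + y) = \<phi> x + \<phi> y" for x y
      using unique[OF \<phi>] subspace_add[OF sub \<phi>[of x] \<phi>[of y]] by simp
    show "\<phi> (c *\<^sub>R x) = c *\<^sub>R \<phi> x" for c x
      using unique[OF \<phi>] subspace_scale[OF sub \<phi>[of x], of c] by simp
  qed
  moreover have "\<bar>\<phi> y\<bar> \<le> norm y" for y
    using le[OF \<phi>[of y]] le[OF \<phi>[of "- y"]] linear_neg[OF \<open>linear \<phi>\<close>, of y] by simp
  moreover have "\<phi> a = norm a"
    using unique[OF \<phi> aS] .
  ultimately show ?thesis by blast
qed

text \<open>The range of \<open>H\<close> is separable even if the target is not. Functionals that
  norm \<open>H\<close> at a dense sequence of points suffice: they are all 1-Lipschitz, so the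
  bound \<open>\<tau>\<close> passes to the other points by continuity of \<open>H\<close>.\<close>

lemma norming_sequence:
  fixes H :: "'a::second_countable_topology \<Rightarrow> 'y::real_normed_vector"
  assumes "continuous_on UNIV H"
  shows "\<exists>\<phi>::nat \<Rightarrow> 'y \<Rightarrow> real. (\<forall>j. linear (\<phi> j)) \<and> (\<forall>j y. \<bar>\<phi> j y\<bar> \<le> norm y) \<and>
    (\<forall>x \<tau>. (\<forall>j. \<bar>\<phi> j (H x)\<bar> \<le> \<tau>) \<longrightarrow> norm (H x) \<le> \<tau>)"
proof -
  obtain D :: "'a set" where D: "countable D" "\<And>X. open X \<Longrightarrow> X \<noteq> {} \<Longrightarrow> \<exists>d\<in>D. d \<in> X"
    using countable_dense_setE by blast
  then have "D \<noteq> {}" using open_UNIV by blast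
  define d where "d = from_nat_into D"
  have d: "\<exists>j. norm (H (d j) - H x) < e" if "e > 0" for x e
  proof -
    have "open (H -` ball (H x) e)"
      using assms by (rule open_vimage[OF open_ball])
    moreover have "H -` ball (H x) e \<noteq> {}" using that by (intro ex_in_conv[THEN iffD1] exI[of _ x]) simp
    ultimately obtain z where "z \<in> D" "H z \<in> ball (H x) e" using D(2) by blast
    then show ?thesis
      unfolding d_def using from_nat_into_surj[OF D(1)] by (metis mem_ball dist_norm norm_minus_commute)
  qed
  have "\<forall>j. \<exists>\<phi>. linear \<phi> \<and> (\<forall>y. \<bar>\<phi> y\<bar> \<le> norm y) \<and> \<phi> (H (d j)) = norm (H (d j))"
    using norming_functional by blast
  then obtain \<phi> where \<phi>: "\<And>j. linear (\<phi> j)" "\<And>j y. \<bar>\<phi> j y\<bar> \<le> norm y" "\<And>j. \<phi> j (H (d j)) = norm (H (d j))"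
    by metis
  have "norm (H x) \<le> \<tau>" if \<tau>: "\<And>j. \<bar>\<phi> j (H x)\<bar> \<le> \<tau>" for x \<tau>
  proof (rule field_le_epsilon)
    fix e :: real assume "e > 0"
    then obtain j where j: "norm (H (d j) - H x) < e / 2" using d[of "e / 2" x] by auto
    have "norm (H x) \<le> norm (H (d j)) + e / 2"
      using j norm_triangle_ineq2[of "H x" "H (d j)"] by (simp add: norm_minus_commute)
    also have "norm (H (d j)) = \<phi> j (H (d j) - H x) + \<phi> j (H x)"
      using \<phi>(3)[of j] linear_diff[OF \<phi>(1)[of j]] by simp
    also have "\<dots> \<le> e / 2 + \<tau>"
      using \<phi>(2)[of j "H (d j) - H x"] j \<tau>[of j] by linarith
    finally show "norm (H x) \<le> \<tau> + e" by simp
  qed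
  then show ?thesis using \<phi> by blast
qed

section \<open>Renorming by countably many functionals\<close>

locale functionals =
  fixes \<phi> :: "nat \<Rightarrow> 'y::real_normed_vector \<Rightarrow> real"
  assumes linear_\<phi>: "linear (\<phi> j)" and \<phi>_bound: "\<bar>\<phi> j y\<bar> \<le> norm y"
begin

text \<open>A positive semidefinite quadratic form. The weights sum to 2, which keeps
  \<open>renorm\<close> below \<open>2 * norm\<close>.\<close>

definition q :: "'y \<Rightarrow> real" where "q y = (\<Sum>j. (1/2)^j * (\<phi> j y)\<^sup>2)"

definition renorm :: "'y \<Rightarrow> real" where "renorm y = sqrt ((norm y)\<^sup>2 + q y)"

lemma term_bound: "(1/2)^j * (\<phi> j y)\<^sup>2 \<le> (1/2)^j * (norm y)\<^sup>2"
  using \<phi>_bound[of j y] by (intro mult_left_mono) (auto simp: abs_le_square_iff[symmetric])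

lemma geometric: "(\<lambda>j. (1/2)^j * (norm y)\<^sup>2) sums (2 * (norm y)\<^sup>2)"
  using sums_mult2[OF geometric_sums[of "1/2::real"], of "(norm y)\<^sup>2"] by simp

lemma q_summable: "summable (\<lambda>j. (1/2)^j * (\<phi> j y)\<^sup>2)"
  by (rule summable_comparison_test'[OF sums_summable[OF geometric[of y]]]) (use term_bound in auto)

lemma q_sums: "(\<lambda>j. (1/2)^j * (\<phi> j y)\<^sup>2) sums q y"
  unfolding q_def using q_summable by (rule summable_sums)

lemma q_nonneg: "0 \<le> q y"
  unfolding q_def by (intro suminf_nonneg q_summable) auto

lemma q_upper: "q y \<le> 2 * (norm y)\<^sup>2"
  using sums_le[OF term_bound q_sums geometric] .

lemma q_lower: "(1/2)^j * (\<phi> j y)\<^sup>2 \<le> q y"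
  unfolding q_def using sum_le_suminf[OF q_summable, of "{j}"] by simp

lemma q_scaleR: "q (c *\<^sub>R y) = c\<^sup>2 * q y"
proof -
  have "(\<lambda>j. c\<^sup>2 * ((1/2)^j * (\<phi> j y)\<^sup>2)) sums (c\<^sup>2 * q y)"
    by (intro sums_mult q_sums)
  then have "(\<lambda>j. (1/2)^j * (\<phi> j (c *\<^sub>R y))\<^sup>2) sums (c\<^sup>2 * q y)"
    by (simp add: linear_cmul[OF linear_\<phi>] power_mult_distrib mult.left_commute)
  then show ?thesis by (rule sums_unique2[OF q_sums])
qed

text \<open>The parallelogram identity with weights, valid term by term. The subtracted summand is
  the convexity defect from which the equality case is read off.\<close>

lemma q_convex:
  "q (l *\<^sub>R u + (1 - l) *\<^sub>R v) = l * q u + (1 - l) * q v - l * (1 - l) * q (u - v)"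
proof -
  have "l * ((1/2)^j * (\<phi> j u)\<^sup>2) + (1 - l) * ((1/2)^j * (\<phi> j v)\<^sup>2)
      - l * (1 - l) * ((1/2)^j * (\<phi> j (u - v))\<^sup>2)
      = (1/2)^j * (\<phi> j (l *\<^sub>R u + (1 - l) *\<^sub>R v))\<^sup>2" for j
  proof -
    have "l * (p * x\<^sup>2) + (1 - l) * (p * y\<^sup>2) - l * (1 - l) * (p * (x - y)\<^sup>2) = p * (l * x + (1 - l) * y)\<^sup>2"
      for x y p :: real
      by (simp add: power2_eq_square algebra_simps)
    then show ?thesis
      by (simp add: linear_add[OF linear_\<phi>] linear_cmul[OF linear_\<phi>] linear_diff[OF linear_\<phi>])
  qed
  moreover have "(\<lambda>j. l * ((1/2)^j * (\<phi> j u)\<^sup>2) + (1 - l) * ((1/2)^j * (\<phi> j v)\<^sup>2)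
      - l * (1 - l) * ((1/2)^j * (\<phi> j (u - v))\<^sup>2))
      sums (l * q u + (1 - l) * q v - l * (1 - l) * q (u - v))"
    by (intro sums_add sums_diff sums_mult q_sums)
  ultimately have "(\<lambda>j. (1/2)^j * (\<phi> j (l *\<^sub>R u + (1 - l) *\<^sub>R v))\<^sup>2)
      sums (l * q u + (1 - l) * q v - l * (1 - l) * q (u - v))"
    by simp
  then show ?thesis by (rule sums_unique2[OF q_sums])
qed

lemma renorm_sq: "(renorm y)\<^sup>2 = (norm y)\<^sup>2 + q y"
  unfolding renorm_def using q_nonneg by simp

lemma renorm_nonneg: "0 \<le> renorm y"
  unfolding renorm_def using q_nonneg by simp

lemma norm_le_renorm: "norm y \<le> renorm y"
  unfolding renorm_def using q_nonneg by (intro real_le_rsqrt) simp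

lemma renorm_le: "renorm y \<le> 2 * norm y"
proof -
  have "(norm y)\<^sup>2 + q y \<le> (2 * norm y)\<^sup>2"
    using q_upper[of y] zero_le_power2[of "norm y"] unfolding power_mult_distrib power2_eq_square[of 2] by linarith
  then show ?thesis unfolding renorm_def by (intro real_le_lsqrt) auto
qed

lemma renorm_eq_0: "renorm y = 0 \<longleftrightarrow> y = 0"
  using norm_le_renorm[of y] renorm_le[of y] by auto

lemma renorm_scaleR: "renorm (c *\<^sub>R y) = \<bar>c\<bar> * renorm y"
proof -
  have "(norm (c *\<^sub>R y))\<^sup>2 + q (c *\<^sub>R y) = c\<^sup>2 * ((norm y)\<^sup>2 + q y)"
    by (simp add: q_scaleR power_mult_distrib algebra_simps)
  then show ?thesis unfolding renorm_def by (simp add: real_sqrt_mult)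
qed

lemma renorm_convex:
  assumes "0 \<le> l" "l \<le> 1"
  shows "(renorm (l *\<^sub>R u + (1 - l) *\<^sub>R v))\<^sup>2 + l * (1 - l) * q (u - v) \<le> l * (renorm u)\<^sup>2 + (1 - l) * (renorm v)\<^sup>2"
proof -
  have "norm (l *\<^sub>R u + (1 - l) *\<^sub>R v) \<le> l * norm u + (1 - l) * norm v"
    using assms by (intro norm_triangle_le) simp
  then have "(norm (l *\<^sub>R u + (1 - l) *\<^sub>R v))\<^sup>2 \<le> (l * norm u + (1 - l) * norm v)\<^sup>2"
    by (intro power_mono) auto
  also have "\<dots> = l * (norm u)\<^sup>2 + (1 - l) * (norm v)\<^sup>2 - l * (1 - l) * (norm u - norm v)\<^sup>2"
    by (simp add: power2_eq_square algebra_simps)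
  also have "\<dots> \<le> l * (norm u)\<^sup>2 + (1 - l) * (norm v)\<^sup>2"
    using assms by simp
  finally show ?thesis unfolding renorm_sq q_convex by (simp add: algebra_simps)
qed

text \<open>Uniform convexity of \<open>q\<close> yields both the triangle inequality and its equality case.\<close>

lemma renorm_add:
  assumes "a \<noteq> 0" "b \<noteq> 0"
  defines "\<alpha> \<equiv> renorm a" and "\<beta> \<equiv> renorm b"
  shows "(renorm (a + b))\<^sup>2 + \<alpha> * \<beta> * q (a /\<^sub>R \<alpha> - b /\<^sub>R \<beta>) \<le> (\<alpha> + \<beta>)\<^sup>2"
proof -
  have pos: "\<alpha> > 0" "\<beta> > 0"
    unfolding \<alpha>_def \<beta>_def using assms renorm_eq_0 renorm_nonneg by (simp_all add: less_le)
  \<comment> \<open>With this weight the convex combination of the two normalised vectors is a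
    multiple of \<open>a + b\<close>; scaling by \<open>(\<alpha> + \<beta>)^2\<close> turns
    \<open>l * (1 - l)\<close> into \<open>\<alpha> * \<beta>\<close>.\<close>
  define l where "l = \<alpha> / (\<alpha> + \<beta>)"
  have l: "0 \<le> l" "l \<le> 1" "1 - l = \<beta> / (\<alpha> + \<beta>)" using pos by (auto simp: l_def field_simps)
  have "l *\<^sub>R (a /\<^sub>R \<alpha>) + (1 - l) *\<^sub>R (b /\<^sub>R \<beta>) = (a + b) /\<^sub>R (\<alpha> + \<beta>)"
    unfolding l(3) unfolding l_def using pos by (simp add: scaleR_add_right field_simps)
  then have "renorm (l *\<^sub>R (a /\<^sub>R \<alpha>) + (1 - l) *\<^sub>R (b /\<^sub>R \<beta>)) = renorm (a + b) / (\<alpha> + \<beta>)"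
    using pos by (simp add: renorm_scaleR divide_inverse mult.commute)
  moreover have "renorm (a /\<^sub>R \<alpha>) = 1" "renorm (b /\<^sub>R \<beta>) = 1"
    using pos by (simp_all add: renorm_scaleR \<alpha>_def[symmetric] \<beta>_def[symmetric])
  ultimately have "(renorm (a + b) / (\<alpha> + \<beta>))\<^sup>2 + l * (1 - l) * q (a /\<^sub>R \<alpha> - b /\<^sub>R \<beta>) \<le> 1"
    using renorm_convex[OF l(1,2), of "a /\<^sub>R \<alpha>" "b /\<^sub>R \<beta>"] by simp
  then have "(\<alpha> + \<beta>)\<^sup>2 * ((renorm (a + b) / (\<alpha> + \<beta>))\<^sup>2 + l * (1 - l) * q (a /\<^sub>R \<alpha> - b /\<^sub>R \<beta>)) \<le> (\<alpha> + \<beta>)\<^sup>2"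
    by (simp add: mult_left_le)
  moreover have "(\<alpha> + \<beta>)\<^sup>2 * (renorm (a + b) / (\<alpha> + \<beta>))\<^sup>2 = (renorm (a + b))\<^sup>2"
    using pos by (simp add: power_divide)
  moreover have "(\<alpha> + \<beta>)\<^sup>2 * (l * (1 - l)) = \<alpha> * \<beta>"
    unfolding l(3) unfolding l_def using pos by (simp add: power2_eq_square)
  ultimately show ?thesis by (simp add: distrib_left mult.assoc[symmetric])
qed

lemma renorm_triangle: "renorm (a + b) \<le> renorm a + renorm b"
proof (cases "a = 0 \<or> b = 0")
  case False
  then have "(renorm (a + b))\<^sup>2 \<le> (renorm a + renorm b)\<^sup>2"
    using renorm_add[of a b] q_nonneg renorm_nonneg by (smt (verit) mult_nonneg_nonneg)
  then show ?thesis by (rule power2_le_imp_le) (simp add: renorm_nonneg)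
qed (use renorm_nonneg in \<open>auto simp: renorm_eq_0\<close>)

text \<open>Equality leaves no room for the defect term of \<open>renorm_add\<close>, so
  \<open>q\<close>, and with it each \<open>\<phi> j\<close>, vanishes at the difference of the
  normalised vectors. The form with products covers zero summands as well.\<close>

lemma renorm_add_eq:
  assumes "renorm (a + b) = renorm a + renorm b"
  shows "renorm b * \<phi> j a = renorm a * \<phi> j b"
proof (cases "a = 0 \<or> b = 0")
  case False
  then have pos: "renorm a > 0" "renorm b > 0"
    using renorm_eq_0 renorm_nonneg by (simp_all add: less_le)
  let ?w = "a /\<^sub>R renorm a - b /\<^sub>R renorm b"
  have "renorm a * renorm b * q ?w \<le> 0"
    using renorm_add[of a b] False assms by simp
  then have "q ?w \<le> 0" using pos by (simp add: mult_le_0_iff)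
  then have "(1/2)^j * (\<phi> j ?w)\<^sup>2 \<le> 0" using q_lower[of j ?w] by simp
  then have "\<phi> j ?w = 0"
    using zero_less_power[of "1/2 :: real" j] by (auto simp: mult_le_0_iff simp del: zero_less_power)
  then have "\<phi> j a / renorm a = \<phi> j b / renorm b"
    by (simp add: linear_diff[OF linear_\<phi>] linear_cmul[OF linear_\<phi>] divide_inverse mult.commute)
  then show ?thesis using pos by (simp add: field_simps)
qed (auto simp: linear_0[OF linear_\<phi>] renorm_eq_0)

lemma equivalent_norm_renorm: "equivalent_norm renorm"
  unfolding equivalent_norm_def
proof (intro conjI allI)
  show "\<exists>c>0. \<exists>C>0. \<forall>y. c * norm y \<le> renorm y \<and> renorm y \<le> C * norm y"
    by (rule exI[of _ 1], simp, rule exI[of _ 2], simp add: norm_le_renorm renorm_le)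
qed (rule renorm_eq_0 renorm_scaleR renorm_triangle)+

end

section \<open>From bushes to oscillating curves\<close>

text \<open>A quantitative failure of differentiability at \<open>a\<close>. The intervals contain
  \<open>a\<close> instead of ending there, because the block of a bush around a given point need
  not start at it.\<close>

definition oscillates :: "(real \<Rightarrow> 'y::real_normed_vector) \<Rightarrow> real \<Rightarrow> real \<Rightarrow> bool" where
  "oscillates F \<epsilon> a \<longleftrightarrow>
     (\<forall>r>0. \<exists>u v u' v'. u \<le> a \<and> a \<le> v \<and> u < v \<and> v - u < r \<and> u' \<le> a \<and> a \<le> v' \<and> u' < v' \<and> v' - u' < r \<and>
        \<epsilon> \<le> norm ((F v - F u) /\<^sub>R (v - u) - (F v' - F u') /\<^sub>R (v' - u')))"

text \<open>A node \<open>E\<close> will occupy an interval of length \<open>m E\<close> over which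
  the curve gains \<open>v E\<close>, so \<open>v E /\<^sub>R m E\<close> is the slope of its chord
  and \<open>k\<close> becomes the Lipschitz constant.\<close>

locale bush =
  fixes T :: "'a set" and m :: "'a \<Rightarrow> real" and v :: "'a \<Rightarrow> 'y::banach" and ch :: "'a \<Rightarrow> 'a list"
    and k \<epsilon> :: real
  assumes m_pos: "E \<in> T \<Longrightarrow> 0 < m E"
    and ch_in: "E \<in> T \<Longrightarrow> c \<in> set (ch E) \<Longrightarrow> c \<in> T"
    and m_sum: "E \<in> T \<Longrightarrow> sum_list (map m (ch E)) = m E"
    and v_sum: "E \<in> T \<Longrightarrow> sum_list (map v (ch E)) = v E"
    and v_bound: "E \<in> T \<Longrightarrow> norm (v E) \<le> k * m E"
    and m_child: "E \<in> T \<Longrightarrow> c \<in> set (ch E) \<Longrightarrow> m c \<le> 3 / 4 * m E"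
    and k_nonneg: "0 \<le> k"
    and separated: "E \<in> T \<Longrightarrow> c \<in> set (ch E) \<Longrightarrow> \<epsilon> \<le> norm (v c /\<^sub>R m c - v E /\<^sub>R m E)"
begin

text \<open>For curves that vanish before time 0 and are constant after time \<open>m c\<close>, the
  sum of the shifted curves is their concatenation.\<close>

fun glue :: "('a \<Rightarrow> real \<Rightarrow> 'y) \<Rightarrow> 'a list \<Rightarrow> real \<Rightarrow> 'y" where
  "glue f [] t = 0"
| "glue f (c # cs) t = f c t + glue f cs (t - m c)"

fun approx :: "nat \<Rightarrow> 'a \<Rightarrow> real \<Rightarrow> 'y" where
  "approx 0 E t = (max 0 (min t (m E)) / m E) *\<^sub>R v E"
| "approx (Suc n) E t = glue (approx n) (ch E) t"

definition curve :: "(real \<Rightarrow> 'y) \<Rightarrow> real \<Rightarrow> 'y \<Rightarrow> bool" where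
  "curve h l w \<longleftrightarrow> (\<forall>t\<le>0. h t = 0) \<and> (\<forall>t\<ge>l. h t = w) \<and> (\<forall>s t. s \<le> t \<longrightarrow> norm (h t - h s) \<le> k * (t - s))"

lemma curve_glue:
  assumes "set cs \<subseteq> T" "\<And>c. c \<in> T \<Longrightarrow> curve (f c) (m c) (v c)"
  shows "curve (glue f cs) (sum_list (map m cs)) (sum_list (map v cs))"
  using assms(1)
proof (induction cs)
  case Nil
  then show ?case by (simp add: curve_def k_nonneg)
next
  case (Cons c cs)
  have c: "curve (f c) (m c) (v c)" "m c > 0" using Cons.prems assms(2) m_pos by auto
  have cs: "curve (glue f cs) (sum_list (map m cs)) (sum_list (map v cs))"
    using Cons by simp
  have nonneg: "0 \<le> sum_list (map m cs)"
    using Cons.prems m_pos by (intro sum_list_nonneg) (auto intro: less_imp_le)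
  have "norm (glue f (c # cs) t - glue f (c # cs) s) \<le> k * (t - s)" if "s \<le> t" for s t
  proof -
    consider "t \<le> m c" | "m c \<le> s" | "s < m c" "m c < t" by linarith
    then show ?thesis
    proof cases
      case 1
      then show ?thesis using c cs that by (simp add: curve_def)
    next
      case 2
      then have "norm (glue f cs (t - m c) - glue f cs (s - m c)) \<le> k * ((t - m c) - (s - m c))"
        using cs that unfolding curve_def by (metis diff_right_mono)
      then show ?thesis using c 2 that by (simp add: curve_def)
    next
      case 3
      have 1: "norm (f c (m c) - f c s) \<le> k * (m c - s)"
        using c 3 unfolding curve_def by (metis less_imp_le)
      have 2: "norm (glue f cs (t - m c) - glue f cs 0) \<le> k * ((t - m c) - 0)"
        using cs 3 unfolding curve_def by (metis diff_ge_0_iff_ge less_imp_le)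
      have "glue f (c # cs) t - glue f (c # cs) s
          = (f c (m c) - f c s) + (glue f cs (t - m c) - glue f cs 0)"
        using c cs 3 by (simp add: curve_def)
      also have "norm \<dots> \<le> k * (m c - s) + k * (t - m c)"
        using 1 2 by (intro norm_triangle_le) simp
      also have "\<dots> = k * (t - s)" by (simp add: algebra_simps)
      finally show ?thesis .
    qed
  qed
  then show ?case using c cs nonneg by (auto simp: curve_def)
qed

lemma curve_approx: "E \<in> T \<Longrightarrow> curve (approx n E) (m E) (v E)"
proof (induction n arbitrary: E)
  case 0
  then have E: "m E > 0" "norm (v E) \<le> k * m E" using m_pos v_bound by auto
  have "norm (approx 0 E t - approx 0 E s) \<le> k * (t - s)" if "s \<le> t" for s t
  proof -
    define d where "d = max 0 (min t (m E)) - max 0 (min s (m E))"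
    have d: "0 \<le> d" "d \<le> t - s" using that E by (auto simp: d_def)
    have "approx 0 E t - approx 0 E s = (d / m E) *\<^sub>R v E"
      by (simp add: d_def scaleR_diff_left[symmetric] diff_divide_distrib)
    then have "norm (approx 0 E t - approx 0 E s) = d / m E * norm (v E)" using d E by simp
    also have "\<dots> \<le> d / m E * (k * m E)" using d E by (intro mult_left_mono) auto
    also have "\<dots> = k * d" using E by simp
    also have "\<dots> \<le> k * (t - s)" using d k_nonneg by (intro mult_left_mono) auto
    finally show ?thesis .
  qed
  then show ?case using E by (simp add: curve_def)
next
  case (Suc n)
  have "curve (glue (approx n) (ch E)) (m E) (v E)"
    using curve_glue[of "ch E" "approx n"] Suc ch_in m_sum v_sum by auto
  then show ?case by (simp add: curve_def)
qed

text \<open>At any time at most one child is under way: earlier ones have reached \<open>v c\<close>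
  in both versions and later ones are still 0 in both. Hence the bound is not multiplied by the
  number of children.\<close>

lemma glue_diff:
  assumes "set cs \<subseteq> T" "\<And>c. c \<in> T \<Longrightarrow> curve (f c) (m c) (v c)" "\<And>c. c \<in> T \<Longrightarrow> curve (f' c) (m c) (v c)"
    and "\<And>c t. c \<in> set cs \<Longrightarrow> norm (f c t - f' c t) \<le> B" "0 \<le> B"
  shows "norm (glue f cs t - glue f' cs t) \<le> B"
  using assms(1,4)
proof (induction cs arbitrary: t)
  case Nil
  then show ?case using assms(5) by simp
next
  case (Cons c cs)
  show ?case
  proof (cases "t \<le> m c")
    case True
    have "curve (glue f cs) (sum_list (map m cs)) (sum_list (map v cs))"
      "curve (glue f' cs) (sum_list (map m cs)) (sum_list (map v cs))"
      using Cons.prems assms by (auto intro!: curve_glue)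
    then have "glue f cs (t - m c) = 0" "glue f' cs (t - m c) = 0"
      using True by (auto simp: curve_def)
    then show ?thesis using Cons.prems by simp
  next
    case False
    then have "f c t = f' c t" using assms(2,3)[of c] Cons.prems by (simp add: curve_def)
    then show ?thesis using Cons by simp
  qed
qed

text \<open>Consecutive approximations agree at the ends of the intervals of depth \<open>n\<close>.
  In between, both are \<open>k\<close>-Lipschitz with the same initial value, and these intervals
  have length at most \<open>(3/4)^n * m E\<close>.\<close>

lemma approx_diff: "E \<in> T \<Longrightarrow> norm (approx (Suc n) E t - approx n E t) \<le> 2 * k * m E * (3 / 4) ^ n"
proof (induction n arbitrary: E t)
  case 0
  have 1: "curve (approx (Suc 0) E) (m E) (v E)" "curve (approx 0 E) (m E) (v E)" "m E > 0"
    using curve_approx 0 m_pos by auto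
  consider "t \<le> 0" | "t \<ge> m E" | "0 < t" "t < m E" by linarith
  then show ?case
  proof cases
    case 3
    then have *: "norm (approx (Suc 0) E t - approx (Suc 0) E 0) \<le> k * (t - 0)"
        "norm (approx 0 E t - approx 0 E 0) \<le> k * (t - 0)"
      using 1(1,2) unfolding curve_def by (meson less_imp_le)+
    have z: "approx (Suc 0) E 0 = 0" "approx 0 E 0 = 0" using 1 unfolding curve_def by blast+
    have "norm (approx (Suc 0) E t - approx 0 E t) \<le> k * t + k * t"
      using * unfolding z by (intro order_trans[OF norm_triangle_ineq4]) simp
    also have "\<dots> \<le> 2 * (k * m E)" using 3 k_nonneg by (simp add: mult_left_mono)
    finally show ?thesis by simp
  next
    case 1
    then show ?thesis using \<open>m E > 0\<close> \<open>curve (approx (Suc 0) E) (m E) (v E)\<close> \<open>curve (approx 0 E) (m E) (v E)\<close> k_nonneg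
      unfolding curve_def by simp
  next
    case 2
    then show ?thesis using \<open>m E > 0\<close> \<open>curve (approx (Suc 0) E) (m E) (v E)\<close> \<open>curve (approx 0 E) (m E) (v E)\<close> k_nonneg
      unfolding curve_def by simp
  qed
next
  case (Suc n)
  have "norm (glue (approx (Suc n)) (ch E) t - glue (approx n) (ch E) t) \<le> 2 * k * m E * (3 / 4) ^ Suc n"
  proof (rule glue_diff)
    show "norm (approx (Suc n) c t - approx n c t) \<le> 2 * k * m E * (3 / 4) ^ Suc n" if "c \<in> set (ch E)" for c t
    proof -
      have "norm (approx (Suc n) c t - approx n c t) \<le> 2 * k * (3/4)^n * m c"
        using Suc.IH[of c t] ch_in[OF Suc.prems that] by (simp add: mult_ac)
      also have "\<dots> \<le> 2 * k * (3/4)^n * (3/4 * m E)"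
        using m_child[OF Suc.prems that] k_nonneg by (intro mult_left_mono) auto
      finally show ?thesis by (simp add: mult_ac)
    qed
    show "0 \<le> 2 * k * m E * (3 / 4) ^ Suc n" using k_nonneg m_pos[OF Suc.prems] by simp
  qed (use Suc.prems ch_in curve_approx in auto)
  then show ?case by (metis approx.simps(2))
qed

definition limit :: "'a \<Rightarrow> real \<Rightarrow> 'y" where
  "limit E t = lim (\<lambda>n. approx n E t)"

lemma approx_LIMSEQ: "E \<in> T \<Longrightarrow> (\<lambda>n. approx n E t) \<longlonglongrightarrow> limit E t"
proof -
  assume E: "E \<in> T"
  have "summable (\<lambda>n. 2 * k * m E * (3 / 4 :: real) ^ n)"
    by (intro summable_mult summable_geometric) simp
  then have "summable (\<lambda>n. approx (Suc n) E t - approx n E t)"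
    by (rule summable_comparison_test[rotated]) (use approx_diff[OF E] in blast)
  then have "convergent (\<lambda>n. approx n E t - approx 0 E t)"
    unfolding summable_iff_convergent sum_lessThan_telescope[of "\<lambda>n. approx n E t"] .
  then have "convergent (\<lambda>n. approx n E t)"
    unfolding convergent_diff_const_right_iff .
  then show ?thesis by (simp add: convergent_LIMSEQ_iff limit_def)
qed

text \<open>Self-similarity of the limit, which makes it possible to zoom in on the interval of a
  node.\<close>

lemma limit_glue: "E \<in> T \<Longrightarrow> limit E t = glue limit (ch E) t"
proof -
  assume E: "E \<in> T"
  have "(\<lambda>n. glue (approx n) cs s) \<longlonglongrightarrow> glue limit cs s" if "set cs \<subseteq> T" for cs s
    using that by (induction cs arbitrary: s) (auto intro!: tendsto_add approx_LIMSEQ)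
  then have "(\<lambda>n. approx (Suc n) E t) \<longlonglongrightarrow> glue limit (ch E) t"
    using ch_in[OF E] by (simp add: subset_iff)
  then show ?thesis
    using LIMSEQ_unique LIMSEQ_Suc approx_LIMSEQ[OF E] by blast
qed

lemma curve_limit: "E \<in> T \<Longrightarrow> curve (limit E) (m E) (v E)"
proof -
  assume E: "E \<in> T"
  note lim = approx_LIMSEQ[OF E] and c = curve_approx[OF E, unfolded curve_def]
  have "limit E t = 0" if "t \<le> 0" for t
    using lim[of t] c that by (simp add: LIMSEQ_const_iff)
  moreover have "limit E t = v E" if "m E \<le> t" for t
    using lim[of t] c that by (simp add: LIMSEQ_const_iff)
  moreover have "norm (limit E t - limit E s) \<le> k * (t - s)" if "s \<le> t" for s t
    by (rule Lim_bounded[OF tendsto_norm[OF tendsto_diff[OF lim lim]], of 0]) (use c that in blast)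
  ultimately show ?thesis by (simp add: curve_def)
qed

section \<open>Zooming in on a point of the curve\<close>

lemma glue_descend:
  assumes "set cs \<subseteq> T" "cs \<noteq> []" "0 \<le> t" "t \<le> sum_list (map m cs)"
  shows "\<exists>c\<in>set cs. \<exists>a\<ge>0. a \<le> t \<and> t \<le> a + m c \<and> a + m c \<le> sum_list (map m cs) \<and>
    (\<forall>s. 0 \<le> s \<longrightarrow> s \<le> m c \<longrightarrow> glue limit cs (a + s) = glue limit cs a + limit c s)"
  using assms
proof (induction cs arbitrary: t)
  case (Cons c cs)
  have c: "curve (limit c) (m c) (v c)" "m c > 0" using Cons.prems curve_limit m_pos by auto
  have cs: "curve (glue limit cs) (sum_list (map m cs)) (sum_list (map v cs))"
    using Cons.prems by (auto intro!: curve_glue curve_limit)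
  have nonneg: "0 \<le> sum_list (map m cs)"
    using Cons.prems m_pos by (intro sum_list_nonneg) (auto intro: less_imp_le)
  show ?case
  proof (cases "t \<le> m c")
    case True
    then show ?thesis
      using c cs nonneg Cons.prems by (intro bexI[of _ c] exI[of _ 0]) (auto simp: curve_def)
  next
    case False
    then have "cs \<noteq> []" using Cons.prems by auto
    then obtain c' a where *: "c' \<in> set cs" "a \<ge> 0" "a \<le> t - m c" "t - m c \<le> a + m c'" "a + m c' \<le> sum_list (map m cs)"
      "\<And>s. 0 \<le> s \<Longrightarrow> s \<le> m c' \<Longrightarrow> glue limit cs (a + s) = glue limit cs a + limit c' s"
      using Cons.IH[of "t - m c"] Cons.prems False by auto
    have "glue limit (c # cs) (a + m c + s) = glue limit (c # cs) (a + m c) + limit c' s"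
      if "0 \<le> s" "s \<le> m c'" for s
      using c *(2) *(6)[OF that] that by (simp add: curve_def algebra_simps)
    then show ?thesis
      using * c by (intro bexI[of _ c'] exI[of _ "a + m c"]) auto
  qed
qed simp

lemma child_descend:
  assumes "E \<in> T" "0 \<le> t" "t \<le> m E"
  shows "\<exists>c\<in>set (ch E). \<exists>a\<ge>0. a \<le> t \<and> t \<le> a + m c \<and> a + m c \<le> m E \<and>
    (\<forall>s. 0 \<le> s \<longrightarrow> s \<le> m c \<longrightarrow> limit E (a + s) = limit E a + limit c s)"
proof -
  have "ch E \<noteq> []" using m_sum[OF assms(1)] m_pos[OF assms(1)] by auto
  then show ?thesis
    using glue_descend[of "ch E" t] assms ch_in m_sum limit_glue by auto
qed

text \<open>Translates nest: inside a block where the curve of \<open>E\<close> is a translate of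
  the curve of \<open>c\<close>, a child of \<open>c\<close> supplies a smaller block around the
  point, and the offsets add up.\<close>

lemma descend:
  assumes "E \<in> T" "0 \<le> t" "t \<le> m E"
  shows "\<exists>c\<in>T. m c \<le> (3 / 4) ^ n * m E \<and> (\<exists>a. a \<le> t \<and> t \<le> a + m c \<and>
    (\<forall>s. 0 \<le> s \<longrightarrow> s \<le> m c \<longrightarrow> limit E (a + s) = limit E a + limit c s))"
proof (induction n)
  case 0
  have "limit E 0 = 0" using curve_limit[OF assms(1)] by (simp add: curve_def)
  then show ?case using assms by (intro bexI[of _ E] conjI exI[of _ 0]) auto
next
  case (Suc n)
  then obtain c a where c: "c \<in> T" "m c \<le> (3 / 4) ^ n * m E" "a \<le> t" "t \<le> a + m c"
    and c_eq: "\<And>s. 0 \<le> s \<Longrightarrow> s \<le> m c \<Longrightarrow> limit E (a + s) = limit E a + limit c s" by blast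
  obtain d b where d: "d \<in> set (ch c)" "b \<ge> 0" "b \<le> t - a" "t - a \<le> b + m d" "b + m d \<le> m c"
    and d_eq: "\<And>s. 0 \<le> s \<Longrightarrow> s \<le> m d \<Longrightarrow> limit c (b + s) = limit c b + limit d s"
    using child_descend[of c "t - a"] c by force
  have dT: "d \<in> T" using ch_in c d by blast
  have "m d \<le> 3 / 4 * m c" using m_child c d by blast
  also have "\<dots> \<le> (3 / 4) ^ Suc n * m E" using c by simp
  finally have "m d \<le> (3 / 4) ^ Suc n * m E" .
  moreover have "limit E (a + b + s) = limit E (a + b) + limit d s" if "0 \<le> s" "s \<le> m d" for s
    using c_eq[of "b + s"] c_eq[of b] d_eq[of s] that d m_pos[OF dT] by (simp add: add.assoc)
  ultimately show ?case
    using dT d by (intro bexI[of _ d] conjI exI[of _ "a + b"]) auto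
qed


text \<open>The block of depth \<open>n\<close> around \<open>a\<close> and the block of a child
  inside it, again around \<open>a\<close>, have chords whose slopes are the averages at a node and
  at its child; \<open>separated\<close> keeps these apart.\<close>

theorem oscillating_curve:
  assumes E: "E \<in> T"
  shows "k-lipschitz_on UNIV (limit E)" "t \<le> 0 \<Longrightarrow> limit E t = 0" "m E \<le> t \<Longrightarrow> limit E t = v E"
    and "0 \<le> a \<Longrightarrow> a \<le> m E \<Longrightarrow> oscillates (limit E) \<epsilon> a"
proof -
  show "t \<le> 0 \<Longrightarrow> limit E t = 0" "m E \<le> t \<Longrightarrow> limit E t = v E"
    using curve_limit[OF E] by (auto simp: curve_def)
  show "k-lipschitz_on UNIV (limit E)"
  proof (rule lipschitz_onI)
    have *: "norm (limit E t - limit E s) \<le> k * (t - s)" if "s \<le> t" for s t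
      using curve_limit[OF E] that by (auto simp: curve_def)
    show "dist (limit E x) (limit E y) \<le> k * dist x y" for x y
      using *[of x y] *[of y x] by (cases "x \<le> y") (auto simp: dist_norm norm_minus_commute)
  qed (rule k_nonneg)
  assume a: "0 \<le> a" "a \<le> m E"
  show "oscillates (limit E) \<epsilon> a"
    unfolding oscillates_def
  proof (intro allI impI)
    fix r :: real assume "r > 0"
    have "(\<lambda>n. (3 / 4) ^ n * m E) \<longlonglongrightarrow> 0 * m E"
      by (intro tendsto_mult_right LIMSEQ_realpow_zero) auto
    then have "\<forall>\<^sub>F n in sequentially. (3 / 4) ^ n * m E < r"
      using \<open>r > 0\<close> by (intro order_tendstoD) auto
    then obtain n where n: "(3 / 4) ^ n * m E < r"
      unfolding eventually_sequentially by blast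
    obtain c b where c: "c \<in> T" "m c \<le> (3 / 4) ^ n * m E" "b \<le> a" "a \<le> b + m c"
      and c_eq: "\<And>s. 0 \<le> s \<Longrightarrow> s \<le> m c \<Longrightarrow> limit E (b + s) = limit E b + limit c s"
      using descend[OF E a, of n] by blast
    obtain d b' where d: "d \<in> set (ch c)" "b' \<ge> 0" "b' \<le> a - b" "a - b \<le> b' + m d" "b' + m d \<le> m c"
      and d_eq: "\<And>s. 0 \<le> s \<Longrightarrow> s \<le> m d \<Longrightarrow> limit c (b' + s) = limit c b' + limit d s"
      using child_descend[of c "a - b"] c by force
    have dT: "d \<in> T" using ch_in c d by blast
    note pos = m_pos[OF c(1)] m_pos[OF dT]
    have 1: "limit E (b + m c) - limit E b = v c"
      using c_eq[of "m c"] pos curve_limit[OF c(1)] by (simp add: curve_def)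
    have 2: "limit E (b + b' + m d) - limit E (b + b') = v d"
      using c_eq[of b'] c_eq[of "b' + m d"] d_eq[of "m d"] d pos curve_limit[OF dT]
      by (simp add: curve_def add.assoc)
    have "\<epsilon> \<le> norm ((limit E (b + b' + m d) - limit E (b + b')) /\<^sub>R ((b + b' + m d) - (b + b'))
        - (limit E (b + m c) - limit E b) /\<^sub>R ((b + m c) - b))"
      using separated[OF c(1) d(1)] unfolding 1 2 by simp
    moreover have "m d < r" "m c < r" using c n d by auto
    ultimately show "\<exists>u v u' v'. u \<le> a \<and> a \<le> v \<and> u < v \<and> v - u < r \<and> u' \<le> a \<and> a \<le> v' \<and> u' < v' \<and> v' - u' < r \<and>
        \<epsilon> \<le> norm ((limit E v - limit E u) /\<^sub>R (v - u) - (limit E v' - limit E u') /\<^sub>R (v' - u'))"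
      using pos c d
      by (intro exI[of _ "b + b'"] exI[of _ "b + b' + m d"] exI[of _ b] exI[of _ "b + m c"]) auto
  qed
qed

end

section \<open>Norm attainment near an oscillating curve\<close>

lemma lip_norm_bound:
  assumes "equivalent_norm N" "f \<in> Lip0 N"
  shows "N (f p - f q) \<le> lip_norm N f * norm (p - q)"
proof (cases "p = q")
  case True
  moreover have "N 0 = 0" using assms(1) unfolding equivalent_norm_def by blast
  ultimately show ?thesis by simp
next
  case False
  obtain L where L: "\<And>p q. N (f p - f q) \<le> L * norm (p - q)"
    using assms(2) by (auto simp: Lip0_def)
  have "N (f p - f q) / norm (p - q) \<le> lip_norm N f"
    unfolding lip_norm_def
  proof (rule cSup_upper)
    show "bdd_above {N (f p - f q) / norm (p - q) |p q. p \<noteq> q}"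
      using L by (intro bdd_aboveI[of _ L]) (auto simp: divide_le_eq)
  qed (use False in blast)
  then show ?thesis using False by (simp add: divide_le_eq)
qed

lemma lip_norm_le:
  fixes f :: "'x::real_normed_vector \<Rightarrow> 'y::real_normed_vector"
  assumes "\<And>p q. N (f p - f q) \<le> L * norm (p - q)" "(e :: 'x) \<noteq> 0"
  shows "lip_norm N f \<le> L"
  unfolding lip_norm_def
proof (rule cSup_least)
  show "{N (f p - f q) / norm (p - q) |p q. p \<noteq> q} \<noteq> {}" using assms(2) by blast
qed (use assms in \<open>auto simp: divide_le_eq\<close>)

lemma oscillating_curve_not_dense:
  fixes F :: "real \<Rightarrow> 'y::real_normed_vector" and e0 :: "'x::real_normed_vector"
  assumes lip: "k-lipschitz_on UNIV F" and "0 < m"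
    and left: "\<And>t. t \<le> 0 \<Longrightarrow> F t = 0" and right: "\<And>t. m \<le> t \<Longrightarrow> F t = w"
    and osc: "\<And>a. 0 \<le> a \<Longrightarrow> a \<le> m \<Longrightarrow> oscillates F \<epsilon> a" and "0 < \<epsilon>"
    and "e0 \<noteq> 0"
  shows "\<exists>N. equivalent_norm N \<and> \<not> dense_in_Lip0 N (SNA N \<union> Der N :: ('x \<Rightarrow> 'y) set)"
proof -
  \<comment> \<open>The scalars stand for reciprocals of lengths. As independent variables they make
    \<open>H\<close> continuous on the whole parameter space, also where
    \<open>u = v\<close>.\<close>
  define H where "H = (\<lambda>(\<alpha>, u, v, \<beta>, u', v'). \<alpha> *\<^sub>R (F v - F u) - \<beta> *\<^sub>R (F v' - F u'))"
  have contF: "continuous_on UNIV F" by (rule lipschitz_on_continuous_on[OF lip])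
  have "continuous_on UNIV H"
    unfolding H_def case_prod_beta
    by (intro continuous_intros continuous_on_compose2[OF contF]) auto
  from norming_sequence[OF this] obtain \<phi> :: "nat \<Rightarrow> 'y \<Rightarrow> real" where
    \<phi>: "\<And>j. linear (\<phi> j)" "\<And>j y. \<bar>\<phi> j y\<bar> \<le> norm y"
    "\<And>x \<tau>. (\<And>j. \<bar>\<phi> j (H x)\<bar> \<le> \<tau>) \<Longrightarrow> norm (H x) \<le> \<tau>"
    by blast
  interpret functionals \<phi> by (rule functionals.intro) (rule \<phi>)+
  define N where "N = renorm"
  note eqN = equivalent_norm_renorm[folded N_def]
  have N_tri: "N (y + z) \<le> N y + N z" for y z unfolding N_def by (rule renorm_triangle)
  have N_scale: "N (c *\<^sub>R y) = \<bar>c\<bar> * N y" for c y unfolding N_def by (rule renorm_scaleR)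
  have N_minus: "N (y - z) = N (z - y)" for y z using N_scale[of "-1" "z - y"] by simp
  have N_tri': "N (y - z) \<le> N y + N z" for y z using N_tri[of y "- z"] N_minus[of 0 z] by simp
  have N_0: "N 0 = 0" using N_scale[of 0 0] by simp
  have \<phi>N: "\<bar>\<phi> j y\<bar> \<le> N y" for j y
    using \<phi>(2)[of j y] norm_le_renorm[of y] unfolding N_def by linarith
  obtain \<xi> :: "'x \<Rightarrow> real" where \<xi>: "linear \<xi>" "\<And>x. \<bar>\<xi> x\<bar> \<le> norm x" "\<xi> e0 = norm e0"
    using norming_functional[of e0] by blast
  note \<xi>_lin = linear_add[OF \<xi>(1)] linear_diff[OF \<xi>(1)] linear_cmul[OF \<xi>(1)]
  \<comment> \<open>The factor 2 comes from \<open>renorm_le\<close>; adding 1 makes positivity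
    immediate.\<close>
  define K where "K = 2 * k + 1"
  have K: "K > 0" "N (F u - F v) \<le> K * \<bar>u - v\<bar>" for u v
  proof -
    have "k \<ge> 0" by (rule lipschitz_on_nonneg[OF lip])
    then show "K > 0" by (simp add: K_def)
    have "N (F u - F v) \<le> 2 * norm (F u - F v)" unfolding N_def by (rule renorm_le)
    also have "norm (F u - F v) \<le> k * \<bar>u - v\<bar>"
      using lipschitz_onD[OF lip, of u v] by (simp add: dist_norm)
    finally show "N (F u - F v) \<le> K * \<bar>u - v\<bar>" by (simp add: K_def algebra_simps)
  qed
  define f where "f = (\<lambda>x. F (\<xi> x))"
  have "N (f p - f q) \<le> K * norm (p - q)" for p q
  proof -
    have "K * \<bar>\<xi> p - \<xi> q\<bar> \<le> K * norm (p - q)"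
      using \<xi>(2)[of "p - q"] K(1) by (simp add: \<xi>_lin)
    then show ?thesis unfolding f_def using K(2)[of "\<xi> p" "\<xi> q"] by linarith
  qed
  then have f: "f \<in> Lip0 N"
    using left[of 0] linear_0[OF \<xi>(1)] by (auto simp: Lip0_def f_def)
  define Lf where "Lf = lip_norm N f"
  have "Lf > 0"
  proof -
    have "\<exists>u v. F u \<noteq> F v"
    proof (rule ccontr)
      assume "\<not> (\<exists>u v. F u \<noteq> F v)"
      then have const: "F u - F v = 0" for u v by simp
      obtain u v u' v' where
        "\<epsilon> \<le> norm ((F v - F u) /\<^sub>R (v - u) - (F v' - F u') /\<^sub>R (v' - u'))"
        using osc[of 0] \<open>0 < m\<close> unfolding oscillates_def by (metis less_imp_le order_refl zero_less_one)
      then show False unfolding const using \<open>0 < \<epsilon>\<close> by simp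
    qed
    then obtain u v where uv: "F u \<noteq> F v" by blast
    have "\<xi> ((t / norm e0) *\<^sub>R e0) = t" for t using \<xi>(3) \<open>e0 \<noteq> 0\<close> by (simp add: \<xi>_lin)
    then obtain p q where pq: "f p \<noteq> f q" unfolding f_def using uv by metis
    then have "N (f p - f q) > 0"
      using renorm_eq_0[of "f p - f q"] renorm_nonneg[of "f p - f q"] unfolding N_def by simp
    then have "0 < lip_norm N f * norm (p - q)"
      using lip_norm_bound[OF eqN f, of p q] by linarith
    then show ?thesis unfolding Lf_def by (simp add: zero_less_mult_iff)
  qed
  \<comment> \<open>Tuned to the derivative case, which needs
    \<open>4 * \<eta> * K < \<epsilon> * (Lf - 3 * \<eta>)\<close>; norm attainment asks for the
    weaker \<open>2 * \<eta> * K < \<epsilon> * (Lf - 2 * \<eta>)\<close>.\<close>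
  define \<eta> where "\<eta> = \<epsilon> * Lf / (8 * (K + \<epsilon>))"
  have \<eta>: "\<eta> > 0" "4 * \<eta> * K + 3 * \<eta> * \<epsilon> < \<epsilon> * Lf" "3 * \<eta> < Lf"
  proof -
    show "\<eta> > 0" using \<open>0 < \<epsilon>\<close> \<open>Lf > 0\<close> K(1) by (simp add: \<eta>_def)
    have e: "\<eta> * (8 * (K + \<epsilon>)) = \<epsilon> * Lf"
      using \<open>0 < \<epsilon>\<close> K(1) by (simp add: \<eta>_def)
    have p: "\<eta> * K > 0" "\<eta> * \<epsilon> > 0" using \<open>\<eta> > 0\<close> K(1) \<open>0 < \<epsilon>\<close> by auto
    show *: "4 * \<eta> * K + 3 * \<eta> * \<epsilon> < \<epsilon> * Lf"
      using e p by (simp add: algebra_simps)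
    then have "(3 * \<eta>) * \<epsilon> < Lf * \<epsilon>" using p by (simp add: algebra_simps)
    then show "3 * \<eta> < Lf" using \<open>0 < \<epsilon>\<close> by simp
  qed
  \<comment> \<open>The candidate limits \<open>l j\<close> are mere numbers, one per functional,
    and need not come from a vector. Subtracting two quotients eliminates them at the price of
    doubling \<open>\<rho>\<close>.\<close>
  have no_osc: False
    if a: "0 \<le> a" "a \<le> m" and "r > 0" "2 * \<rho> < \<epsilon>"
      and \<rho>: "\<And>u v j. u \<le> a \<Longrightarrow> a \<le> v \<Longrightarrow> u < v \<Longrightarrow> v - u < r \<Longrightarrow> \<bar>\<phi> j (F v - F u) / (v - u) - l j\<bar> \<le> \<rho>"
    for a r \<rho> l
  proof -
    obtain u v u' v' where uv: "u \<le> a" "a \<le> v" "u < v" "v - u < r" "u' \<le> a" "a \<le> v'" "u' < v'" "v' - u' < r"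
      and sep: "\<epsilon> \<le> norm ((F v - F u) /\<^sub>R (v - u) - (F v' - F u') /\<^sub>R (v' - u'))"
      using osc[OF a] \<open>r > 0\<close> unfolding oscillates_def by blast
    have "norm (H (inverse (v - u), u, v, inverse (v' - u'), u', v')) \<le> 2 * \<rho>"
    proof (rule \<phi>(3))
      fix j
      have "\<phi> j (H (inverse (v - u), u, v, inverse (v' - u'), u', v'))
          = (\<phi> j (F v - F u) / (v - u) - l j) - (\<phi> j (F v' - F u') / (v' - u') - l j)"
        unfolding H_def prod.case linear_diff[OF \<phi>(1), of _ "_ *\<^sub>R _"] linear_cmul[OF \<phi>(1)]
        by (simp add: divide_inverse mult.commute)
      then show "\<bar>\<phi> j (H (inverse (v - u), u, v, inverse (v' - u'), u', v'))\<bar> \<le> 2 * \<rho>"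
        using \<rho>[OF uv(1-4), of j] \<rho>[OF uv(5-8), of j] by linarith
    qed
    then show False using sep \<open>2 * \<rho> < \<epsilon>\<close> by (simp add: H_def)
  qed
  have "\<not> dense_in_Lip0 N (SNA N \<union> Der N :: ('x \<Rightarrow> 'y) set)"
  proof
    assume "dense_in_Lip0 N (SNA N \<union> Der N :: ('x \<Rightarrow> 'y) set)"
    then obtain g :: "'x \<Rightarrow> 'y" where gA: "g \<in> SNA N \<union> Der N" and fg: "lip_norm N (\<lambda>x. f x - g x) < \<eta>"
      using f \<eta>(1) unfolding dense_in_Lip0_def by blast
    have g: "g \<in> Lip0 N" using gA by (auto simp: SNA_def Der_def)
    define \<Delta> where "\<Delta> x = f x - g x" for x
    define L where "L = lip_norm N g"
    have g_bound: "N (g p - g q) \<le> L * norm (p - q)" for p q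
      unfolding L_def by (rule lip_norm_bound[OF eqN g])
    have \<Delta>0: "\<Delta> \<in> Lip0 N"
    proof -
      have "N (\<Delta> p - \<Delta> q) \<le> (Lf + L) * norm (p - q)" for p q
        using N_tri'[of "f p - f q" "g p - g q"] lip_norm_bound[OF eqN f, of p q] g_bound[of p q]
        by (simp add: \<Delta>_def Lf_def algebra_simps)
      then show ?thesis using f g by (auto simp: Lip0_def \<Delta>_def)
    qed
    have \<Delta>: "N (\<Delta> p - \<Delta> q) \<le> \<eta> * norm (p - q)" for p q
    proof -
      have "lip_norm N \<Delta> \<le> \<eta>" using fg by (simp add: \<Delta>_def[abs_def])
      then have "lip_norm N \<Delta> * norm (p - q) \<le> \<eta> * norm (p - q)" by (simp add: mult_right_mono)
      then show ?thesis using lip_norm_bound[OF eqN \<Delta>0, of p q] by linarith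
    qed
    have f_eq: "f p - f q = (g p - g q) + (\<Delta> p - \<Delta> q)" for p q by (simp add: \<Delta>_def)
    have "N (f p - f q) \<le> (L + \<eta>) * norm (p - q)" for p q
      using N_tri[of "g p - g q" "\<Delta> p - \<Delta> q"] g_bound[of p q] \<Delta>[of p q]
      unfolding f_eq by (simp add: algebra_simps)
    from lip_norm_le[OF this \<open>e0 \<noteq> 0\<close>] have L: "Lf \<le> L + \<eta>" by (simp add: Lf_def)
    from gA show False
    proof
      assume "g \<in> SNA N"
      then obtain p q where pq: "p \<noteq> q" "L = N (g p - g q) / norm (p - q)"
        by (auto simp: SNA_def L_def)
      define d where "d = norm (p - q)"
      define c where "c = \<xi> q - \<xi> p"
      define x where "x s = p + s *\<^sub>R (q - p)" for s
      have d: "d > 0" "N (g q - g p) = L * d" using pq by (auto simp: d_def N_minus)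
      have x_diff: "norm (x t - x s) = \<bar>t - s\<bar> * d" for s t
      proof -
        have "x t - x s = (t - s) *\<^sub>R (q - p)" by (simp add: x_def scaleR_diff_left)
        then show ?thesis by (simp add: d_def norm_minus_commute)
      qed
      have x01: "x 0 = p" "x 1 = q" by (auto simp: x_def)
      have \<xi>x: "\<xi> (x s) = \<xi> p + s * c" for s by (simp add: x_def c_def \<xi>_lin)
      \<comment> \<open>The bounds for the two parts of the segment add up to the attained value
        \<open>L * d\<close>, so both are equalities and the triangle inequality is sharp.
        Proportionality of the functionals then has the ratio \<open>s : 1 - s\<close>.\<close>
      have affine: "\<phi> j (g (x s) - g p) = s * \<phi> j (g q - g p)" if "0 \<le> s" "s \<le> 1" for s j
      proof -
        let ?a = "g (x s) - g p" and ?b = "g q - g (x s)"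
        have "N ?a \<le> L * (s * d)" "N ?b \<le> L * ((1 - s) * d)"
          using g_bound[of "x s" "x 0"] g_bound[of "x 1" "x s"] that unfolding x_diff by (auto simp: x01)
        moreover have sum: "?a + ?b = g q - g p" by simp
        moreover have "N (?a + ?b) \<le> N ?a + N ?b" by (rule N_tri)
        moreover have "L * (s * d) + L * ((1 - s) * d) = L * d" by (simp add: algebra_simps)
        ultimately have eq: "N ?a = L * (s * d)" "N ?b = L * ((1 - s) * d)" "N (?a + ?b) = N ?a + N ?b"
          using d(2) by auto
        have "N ?b * \<phi> j ?a = N ?a * \<phi> j ?b"
          using eq(3) unfolding N_def by (rule renorm_add_eq)
        then have "(L * d) * ((1 - s) * \<phi> j ?a) = (L * d) * (s * \<phi> j ?b)"
          unfolding eq by (simp add: mult_ac)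
        moreover have "L * d \<noteq> 0" using L \<eta> d by auto
        ultimately have "(1 - s) * \<phi> j ?a = s * \<phi> j ?b" by simp
        moreover have "\<phi> j (g q - g p) = \<phi> j ?a + \<phi> j ?b"
          unfolding sum[symmetric] linear_add[OF \<phi>(1)] ..
        ultimately show ?thesis by (simp add: algebra_simps)
      qed
      \<comment> \<open>One \<open>\<eta>\<close> is lost in passing from \<open>g\<close> to
        \<open>f\<close>, the other in comparing \<open>L\<close> with \<open>Lf\<close>.\<close>
      have f_big: "N (f q - f p) \<ge> (Lf - 2 * \<eta>) * d"
      proof -
        have "L * d \<le> N (f q - f p) + N (\<Delta> q - \<Delta> p)"
          using N_tri'[of "f q - f p" "\<Delta> q - \<Delta> p"] d(2) unfolding f_eq by simp
        moreover have "N (\<Delta> q - \<Delta> p) \<le> \<eta> * d" using \<Delta>[of q p] by (simp add: d_def norm_minus_commute)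
        moreover have "(Lf - 2 * \<eta>) * d \<le> (L - \<eta>) * d" using L d by (intro mult_right_mono) auto
        ultimately show ?thesis by (simp add: algebra_simps)
      qed
      \<comment> \<open>The growth of \<open>f\<close> passes through \<open>\<xi>\<close>, so
        \<open>\<xi>\<close> must change along the segment by an amount comparable to
        \<open>d\<close>. This controls the error \<open>\<eta> * d / \<bar>c\<bar>\<close>
        below.\<close>
      have Kc: "(Lf - 2 * \<eta>) * d \<le> K * \<bar>c\<bar>"
        using f_big K(2)[of "\<xi> q" "\<xi> p"] by (simp add: f_def c_def)
      have pos: "0 < (Lf - 2 * \<eta>) * d" using \<eta> d by simp
      then have "c \<noteq> 0" using Kc by auto
      define lo hi where "lo = min (\<xi> p) (\<xi> q)" and "hi = max (\<xi> p) (\<xi> q)"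
      have "f q \<noteq> f p" using f_big pos N_0 by auto
      then have "lo < m" "0 < hi" "lo < hi"
        using left[of "\<xi> p"] left[of "\<xi> q"] right[of "\<xi> p"] right[of "\<xi> q"] \<open>c \<noteq> 0\<close>
        unfolding f_def lo_def hi_def c_def by (smt (verit))+
      \<comment> \<open>The midpoint of the overlap of \<open>[lo, hi]\<close> with
        \<open>[0, m]\<close>. The overlap is nondegenerate, since otherwise \<open>F\<close> would
        take equal values at \<open>lo\<close> and \<open>hi\<close>; and \<open>a\<close> is
        interior to \<open>[lo, hi]\<close>, so short intervals around it come from the
        segment.\<close>
      define a where "a = (max lo 0 + min hi m) / 2"
      have a: "lo < a" "a < hi" "0 \<le> a" "a \<le> m"
        using \<open>lo < m\<close> \<open>0 < hi\<close> \<open>lo < hi\<close> \<open>0 < m\<close> unfolding a_def by (auto simp: min_def max_def)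
      have unit: "0 \<le> (u - \<xi> p) / c" "(u - \<xi> p) / c \<le> 1" if "lo \<le> u" "u \<le> hi" for u
        using that \<open>c \<noteq> 0\<close> unfolding lo_def hi_def c_def
        by (auto simp: min_def max_def divide_le_eq zero_le_divide_iff split: if_splits)
      show False
      proof (rule no_osc)
        show "0 \<le> a" "a \<le> m" by fact+
        show "min (a - lo) (hi - a) > 0" using a by simp
        have "2 * \<eta> * d * K < \<epsilon> * ((Lf - 2 * \<eta>) * d)"
        proof -
          have "2 * \<eta> * K < \<epsilon> * (Lf - 2 * \<eta>)"
          proof -
            have "\<eta> * K > 0" "\<eta> * \<epsilon> > 0" using \<eta>(1) K(1) \<open>0 < \<epsilon>\<close> by auto
            then show ?thesis using \<eta>(2) by (simp add: algebra_simps)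
          qed
          then have "2 * \<eta> * K * d < \<epsilon> * (Lf - 2 * \<eta>) * d" using d by (intro mult_strict_right_mono)
          then show ?thesis by (simp add: mult_ac)
        qed
        also have "\<dots> \<le> \<epsilon> * (K * \<bar>c\<bar>)" using Kc \<open>0 < \<epsilon>\<close> by (intro mult_left_mono) auto
        finally have "2 * \<eta> * d < \<epsilon> * \<bar>c\<bar>" using K(1) by (simp add: mult_ac)
        then show "2 * (\<eta> * d / \<bar>c\<bar>) < \<epsilon>" using \<open>c \<noteq> 0\<close> by (simp add: divide_less_eq mult_ac)
        fix u v j assume uv: "u \<le> a" "a \<le> v" "u < v" "v - u < min (a - lo) (hi - a)"
        define s t where "s = (u - \<xi> p) / c" and "t = (v - \<xi> p) / c"
        have st: "0 \<le> s" "s \<le> 1" "0 \<le> t" "t \<le> 1"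
          unfolding s_def t_def using uv by (auto intro!: unit)
        have "\<xi> (x s) = u" "\<xi> (x t) = v" unfolding \<xi>x s_def t_def using \<open>c \<noteq> 0\<close> by auto
        then have "F v - F u = f (x t) - f (x s)" by (simp add: f_def)
        also have "\<dots> = (\<Delta> (x t) - \<Delta> (x s)) + ((g (x t) - g p) - (g (x s) - g p))"
          by (simp add: \<Delta>_def)
        finally have "\<phi> j (F v - F u) = \<phi> j (\<Delta> (x t) - \<Delta> (x s)) + (\<phi> j (g (x t) - g p) - \<phi> j (g (x s) - g p))"
          by (simp only: linear_add[OF \<phi>(1)] linear_diff[OF \<phi>(1)])
        also have "\<dots> = \<phi> j (\<Delta> (x t) - \<Delta> (x s)) + (t - s) * \<phi> j (g q - g p)"
          using affine st by (simp add: algebra_simps)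
        also have "t - s = (v - u) / c" by (simp add: s_def t_def diff_divide_distrib)
        finally have eq: "\<phi> j (F v - F u) / (v - u) - \<phi> j (g q - g p) / c = \<phi> j (\<Delta> (x t) - \<Delta> (x s)) / (v - u)"
          using uv \<open>c \<noteq> 0\<close> by (simp add: field_simps)
        have "\<bar>\<phi> j (\<Delta> (x t) - \<Delta> (x s))\<bar> \<le> \<eta> * (\<bar>t - s\<bar> * d)"
          using \<phi>N[of j "\<Delta> (x t) - \<Delta> (x s)"] \<Delta>[of "x t" "x s"] unfolding x_diff by linarith
        also have "\<bar>t - s\<bar> = (v - u) / \<bar>c\<bar>" using uv by (simp add: s_def t_def diff_divide_distrib[symmetric] abs_divide)
        finally have "\<bar>\<phi> j (\<Delta> (x t) - \<Delta> (x s))\<bar> / (v - u) \<le> \<eta> * d / \<bar>c\<bar>"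
          using uv by (simp add: divide_le_eq mult_ac)
        then show "\<bar>\<phi> j (F v - F u) / (v - u) - \<phi> j (g q - g p) / c\<bar> \<le> \<eta> * d / \<bar>c\<bar>"
          unfolding eq using uv by (simp add: abs_divide)
      qed
    next
      assume "g \<in> Der N"
      then obtain x e z where e: "norm e = 1" and z: "has_dir_derivative N g x e z" "N z = L"
        by (auto simp: Der_def L_def)
      define c where "c = \<xi> e"
      have "\<bar>c\<bar> \<le> 1" using \<xi>(2)[of e] e by (simp add: c_def)
      have "\<forall>\<^sub>F t in at 0. N ((g (x + t *\<^sub>R e) - g x) /\<^sub>R t - z) < \<eta>"
        using z(1) \<eta>(1) unfolding has_dir_derivative_def by (rule order_tendstoD(2))
      then obtain r where r: "r > 0"
        "\<And>t. t \<noteq> 0 \<Longrightarrow> \<bar>t\<bar> < r \<Longrightarrow> N ((g (x + t *\<^sub>R e) - g x) /\<^sub>R t - z) < \<eta>"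
        unfolding eventually_at by (auto simp: dist_norm)
      \<comment> \<open>One \<open>\<eta>\<close> comes from the difference quotient of
        \<open>g\<close>, the other from replacing \<open>g\<close> by \<open>f\<close>.\<close>
      have approx: "N (F (\<xi> x + t * c) - F (\<xi> x) - t *\<^sub>R z) \<le> 2 * \<eta> * \<bar>t\<bar>" if "\<bar>t\<bar> < r" for t
      proof (cases "t = 0")
        case False
        have "F (\<xi> x + t * c) - F (\<xi> x) - t *\<^sub>R z
            = t *\<^sub>R ((g (x + t *\<^sub>R e) - g x) /\<^sub>R t - z) + (\<Delta> (x + t *\<^sub>R e) - \<Delta> x)"
          using False by (simp add: \<Delta>_def f_def c_def \<xi>_lin scaleR_diff_right)
        also have "N \<dots> \<le> \<bar>t\<bar> * \<eta> + \<eta> * \<bar>t\<bar>"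
          using r(2)[OF False that] \<Delta>[of "x + t *\<^sub>R e" x] e
          by (intro order_trans[OF N_tri] add_mono) (auto simp: N_scale mult_left_mono less_imp_le)
        finally show ?thesis by simp
      qed (simp add: N_0)
      have big: "\<bar>t\<bar> * (L - 2 * \<eta>) \<le> N (F (\<xi> x + t * c) - F (\<xi> x))" if "\<bar>t\<bar> < r" for t
      proof -
        have "N (t *\<^sub>R z) \<le> N (F (\<xi> x + t * c) - F (\<xi> x)) + N (F (\<xi> x + t * c) - F (\<xi> x) - t *\<^sub>R z)"
          using N_tri'[of "F (\<xi> x + t * c) - F (\<xi> x)" "F (\<xi> x + t * c) - F (\<xi> x) - t *\<^sub>R z"] by simp
        then show ?thesis using approx[OF that] by (simp add: N_scale z(2) algebra_simps)
      qed
      \<comment> \<open>Any nonzero time below \<open>r\<close> in modulus would serve. Comparing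
        growth with the Lipschitz bound shows that \<open>\<xi>\<close> is not too small on the
        direction \<open>e\<close>.\<close>
      have "\<bar>r / 2\<bar> * (L - 2 * \<eta>) \<le> K * \<bar>(\<xi> x + r / 2 * c) - \<xi> x\<bar>"
        by (rule order_trans[OF big K(2)]) (use r(1) in simp)
      also have "\<dots> = \<bar>r / 2\<bar> * (K * \<bar>c\<bar>)" by (simp add: abs_mult)
      finally have "L - 2 * \<eta> \<le> K * \<bar>c\<bar>" using r(1) by (subst (asm) mult_le_cancel_left_pos) auto
      then have Kc: "Lf - 3 * \<eta> \<le> K * \<bar>c\<bar>" using L by simp
      have "c \<noteq> 0" using Kc \<eta>(3) by auto
      \<comment> \<open>Keeps \<open>\<xi> x\<close> away from the constant parts of
        \<open>F\<close>: there \<open>z\<close> would have \<open>N\<close>-norm at most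
        \<open>2 * \<eta>\<close>, which is less than \<open>L\<close>.\<close>
      have const: False if "\<delta> > 0" "\<And>h. \<bar>h\<bar> \<le> \<delta> \<Longrightarrow> F (\<xi> x + h) = F (\<xi> x)" for \<delta>
      proof -
        define t where "t = min (r / 2) \<delta>"
        have t: "0 < t" "t < r" "t \<le> \<delta>" using that(1) r(1) by (auto simp: t_def)
        have "\<bar>t * c\<bar> \<le> t * 1" unfolding abs_mult using t \<open>\<bar>c\<bar> \<le> 1\<close> by (intro mult_mono) auto
        then have "F (\<xi> x + t * c) = F (\<xi> x)" using t by (intro that(2)) simp
        then have "t * (L - 2 * \<eta>) \<le> 0" using big[of t] t N_0 by simp
        then show False using t L \<eta>(3) by (simp add: mult_le_0_iff)
      qed
      have "0 \<le> \<xi> x"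
        using const[of "- \<xi> x / 2"] left by (intro leI notI) auto
      have "\<xi> x \<le> m"
        using const[of "(\<xi> x - m) / 2"] right by (intro leI notI) (auto simp: field_simps abs_le_iff)
      show False
      proof (rule no_osc)
        show "0 \<le> \<xi> x" "\<xi> x \<le> m" by fact+
        show "r * \<bar>c\<bar> > 0" using r \<open>c \<noteq> 0\<close> by simp
        have "4 * \<eta> * K < \<epsilon> * (Lf - 3 * \<eta>)" using \<eta>(2) by (simp add: algebra_simps)
        also have "\<dots> \<le> \<epsilon> * (K * \<bar>c\<bar>)" using Kc \<open>0 < \<epsilon>\<close> by (intro mult_left_mono) auto
        finally have "4 * \<eta> < \<epsilon> * \<bar>c\<bar>" using K(1) by (simp add: mult_ac)
        then show "2 * (2 * \<eta> / \<bar>c\<bar>) < \<epsilon>" using \<open>c \<noteq> 0\<close> by (simp add: divide_less_eq)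
        fix u v j assume uv: "u \<le> \<xi> x" "\<xi> x \<le> v" "u < v" "v - u < r * \<bar>c\<bar>"
        define s t where "s = (u - \<xi> x) / c" and "t = (v - \<xi> x) / c"
        have st: "\<bar>s\<bar> = (\<xi> x - u) / \<bar>c\<bar>" "\<bar>t\<bar> = (v - \<xi> x) / \<bar>c\<bar>"
          using uv by (auto simp: s_def t_def abs_divide)
        have "\<bar>s\<bar> < r" "\<bar>t\<bar> < r" unfolding st using uv \<open>c \<noteq> 0\<close> by (auto simp: divide_less_eq)
        then have *: "N (F v - F (\<xi> x) - t *\<^sub>R z) \<le> 2 * \<eta> * \<bar>t\<bar>" "N (F u - F (\<xi> x) - s *\<^sub>R z) \<le> 2 * \<eta> * \<bar>s\<bar>"
          using approx[of s] approx[of t] \<open>c \<noteq> 0\<close> by (auto simp: s_def t_def)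
        have ts: "t - s = (v - u) / c" by (simp add: s_def t_def diff_divide_distrib)
        \<comment> \<open>As \<open>\<xi> x\<close> lies between \<open>u\<close> and
          \<open>v\<close>, the numbers \<open>\<bar>s\<bar>\<close> and
          \<open>\<bar>t\<bar>\<close> add up to \<open>(v - u) / \<bar>c\<bar>\<close>. So the
          errors on the two sides sum to a multiple of \<open>v - u\<close>, however unevenly the
          interval is divided.\<close>
        have "F v - F u - ((v - u) / c) *\<^sub>R z = (F v - F (\<xi> x) - t *\<^sub>R z) - (F u - F (\<xi> x) - s *\<^sub>R z)"
          unfolding ts[symmetric] by (simp add: scaleR_diff_left)
        also have "N \<dots> \<le> 2 * \<eta> * \<bar>t\<bar> + 2 * \<eta> * \<bar>s\<bar>" using * N_tri' add_mono order_trans by blast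
        also have "\<dots> = 2 * \<eta> / \<bar>c\<bar> * (v - u)" unfolding st using \<open>c \<noteq> 0\<close> by (simp add: field_simps)
        finally have "\<bar>\<phi> j (F v - F u - ((v - u) / c) *\<^sub>R z)\<bar> \<le> 2 * \<eta> / \<bar>c\<bar> * (v - u)"
          using \<phi>N order_trans by blast
        moreover have "\<phi> j (F v - F u) / (v - u) - \<phi> j z / c = \<phi> j (F v - F u - ((v - u) / c) *\<^sub>R z) / (v - u)"
        proof -
          have "A / w - B / c = (A - w / c * B) / w" if "w \<noteq> 0" for A B w :: real
            using that \<open>c \<noteq> 0\<close> by (simp add: field_simps)
          from this[of "v - u"] show ?thesis
            unfolding linear_diff[OF \<phi>(1), of _ "F v - F u"] linear_cmul[OF \<phi>(1)] using uv by simp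
        qed
        ultimately show "\<bar>\<phi> j (F v - F u) / (v - u) - \<phi> j z / c\<bar> \<le> 2 * \<eta> / \<bar>c\<bar>"
          using uv by (simp add: abs_divide divide_le_eq)
      qed
    qed
  qed
  then show ?thesis using eqN by blast
qed

section \<open>Vector measures\<close>

text \<open>A maximal disjoint family of good pieces of positive measure is countable because the
  measure is finite, and leaves a null set because a larger remainder would contain one more piece.
  \<open>P {}\<close> allows padding to a sequence.\<close>

lemma (in finite_measure) exhaustion:
  assumes A: "A \<in> sets M" and "P {}"
    and ex: "\<And>R. R \<in> sets M \<Longrightarrow> R \<subseteq> A \<Longrightarrow> 0 < measure M R \<Longrightarrow> \<exists>B\<in>sets M. B \<subseteq> R \<and> P B \<and> 0 < measure M B"
  shows "\<exists>B :: nat \<Rightarrow> 'a set. range B \<subseteq> sets M \<and> disjoint_family B \<and> (\<forall>i. P (B i) \<and> B i \<subseteq> A) \<and>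
    measure M (A - (\<Union>i. B i)) = 0"
proof -
  define \<P> where "\<P> = {B \<in> sets M. B \<subseteq> A \<and> P B \<and> 0 < measure M B}"
  define \<D> where "\<D> = {C. C \<subseteq> \<P> \<and> disjoint C}"
  have "\<Union>\<C> \<in> \<D>" if "subset.chain \<D> \<C>" for \<C>
  proof -
    have "\<C> \<subseteq> \<D>" and cmp: "\<And>X Y. X \<in> \<C> \<Longrightarrow> Y \<in> \<C> \<Longrightarrow> X \<subseteq> Y \<or> Y \<subseteq> X"
      using that by (auto simp: subset.chain_def)
    have "disjoint (\<Union>\<C>)"
    proof (rule pairwiseI)
      fix a b assume "a \<in> \<Union>\<C>" "b \<in> \<Union>\<C>" "a \<noteq> b"
      then obtain X Y where XY: "X \<in> \<C>" "a \<in> X" "Y \<in> \<C>" "b \<in> Y" by blast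
      then obtain Z where Z: "Z \<in> \<C>" "a \<in> Z" "b \<in> Z" using cmp[of X Y] by blast
      then have "disjoint Z" using \<open>\<C> \<subseteq> \<D>\<close> by (auto simp: \<D>_def)
      then show "disjnt a b" using Z \<open>a \<noteq> b\<close> by (auto dest: pairwiseD)
    qed
    then show ?thesis using \<open>\<C> \<subseteq> \<D>\<close> unfolding \<D>_def by blast
  qed
  from subset_Zorn'[OF this] obtain C where C: "C \<in> \<D>" and max: "\<And>X. X \<in> \<D> \<Longrightarrow> C \<subseteq> X \<Longrightarrow> X = C"
    by blast
  have C\<P>: "C \<subseteq> \<P>" and disj: "disjoint C" using C by (auto simp: \<D>_def)
  have "countable C"
  proof -
    have "sum (measure M) F \<le> measure M (space M)" if "F \<subseteq> C" "finite F" for F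
    proof -
      have "disjoint_family_on id F" using disj that(1) by (auto simp: disjoint_family_on_def disjoint_def)
      then have "sum (measure M) F = measure M (\<Union>F)"
        using finite_measure_finite_Union[of F id] that C\<P> by (force simp: \<P>_def)
      also have "\<dots> \<le> measure M (space M)" by (rule bounded_measure)
      finally show ?thesis .
    qed
    then have "measure M summable_on C"
      by (intro nonneg_bdd_above_summable_on bdd_aboveI[of _ "measure M (space M)"]) auto
    then have "countable {B\<in>C. measure M B \<noteq> 0}" by (rule summable_countable_real)
    moreover have "{B\<in>C. measure M B \<noteq> 0} = C" using C\<P> by (auto simp: \<P>_def)
    ultimately show ?thesis by simp
  qed
  \<comment> \<open>Indices that code no member of \<open>C\<close> get the empty set, so
    \<open>C\<close> may be finite or empty.\<close>
  define B where "B i = (if i \<in> to_nat_on C ` C then from_nat_into C i else {})" for i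
  have B_cases: "B i = {} \<or> B i \<in> C \<and> to_nat_on C (B i) = i" for i
    using \<open>countable C\<close> by (auto simp: B_def)
  have B_UN: "(\<Union>i. B i) = \<Union>C"
  proof
    show "(\<Union>i. B i) \<subseteq> \<Union>C" using B_cases by blast
    have "X = B (to_nat_on C X)" if "X \<in> C" for X using that \<open>countable C\<close> by (simp add: B_def)
    then show "\<Union>C \<subseteq> (\<Union>i. B i)" by blast
  qed
  have "B i \<in> sets M" for i
    using B_cases[of i] C\<P> by (auto simp: \<P>_def)
  then have B_sets: "range B \<subseteq> sets M" by blast
  show ?thesis
  proof (intro exI[of _ B] conjI allI)
    show "range B \<subseteq> sets M" by fact
    show "disjoint_family B"
      unfolding disjoint_family_on_def
    proof (intro ballI impI)
      fix i j :: nat assume "i \<noteq> j"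
      then show "B i \<inter> B j = {}"
        using B_cases[of i] B_cases[of j] disjointD[OF disj, of "B i" "B j"]
        by (cases "B i = B j") auto
    qed
    show "P (B i)" "B i \<subseteq> A" for i using B_cases[of i] C\<P> \<open>P {}\<close> by (auto simp: \<P>_def)
    show "measure M (A - (\<Union>i. B i)) = 0"
    proof (rule ccontr)
      assume "measure M (A - (\<Union>i. B i)) \<noteq> 0"
      then have "0 < measure M (A - (\<Union>i. B i))" by (simp add: zero_less_measure_iff)
      moreover have "A - (\<Union>i. B i) \<in> sets M" using A B_sets by auto
      ultimately obtain D where D: "D \<in> sets M" "D \<subseteq> A - (\<Union>i. B i)" "P D" "0 < measure M D"
        using ex[of "A - (\<Union>i. B i)"] by blast
      have "insert D C \<in> \<D>"
        using D C\<P> disj unfolding \<D>_def B_UN by (auto simp: \<P>_def pairwise_insert disjnt_def)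
      then have "D \<in> C" using max by blast
      then have "D = {}" using D(2) unfolding B_UN by blast
      then show False using D(4) by simp
    qed
  qed
qed

lemma (in finite_measure) remainder_LIMSEQ:
  assumes "A \<in> sets M" "range B \<subseteq> sets M" "measure M (A - (\<Union>i::nat. B i)) = 0"
  shows "(\<lambda>n. measure M (A - (\<Union>i<n. B i))) \<longlonglongrightarrow> 0"
proof -
  have "(\<lambda>n. measure M (A - (\<Union>i<n. B i))) \<longlonglongrightarrow> measure M (\<Inter>n. A - (\<Union>i<n. B i))"
  proof (rule finite_Lim_measure_decseq)
    show "range (\<lambda>n. A - (\<Union>i<n. B i)) \<subseteq> sets M" using assms by auto
    show "decseq (\<lambda>n. A - (\<Union>i<n. B i))" by (intro decseq_SucI) auto
  qed
  also have "(\<Inter>n. A - (\<Union>i<n. B i)) = A - (\<Union>i. B i)" by blast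
  finally show ?thesis using assms by simp
qed

text \<open>Stated for arbitrary \<open>h\<close> because it serves both the measure and
  \<open>G\<close>. The head \<open>c0\<close> is the piece \<open>B i0\<close> enlarged by a
  remainder with value \<open>r\<close>; the pieces filtered out contribute 0.\<close>

lemma sum_list_absorb:
  fixes h :: "'b \<Rightarrow> 'c::comm_monoid_add"
  assumes "i0 < N" "h c0 = h (B i0) + r" "\<And>i. i < N \<Longrightarrow> \<not> Q i \<Longrightarrow> h (B i) = 0"
  shows "sum_list (map h (c0 # map B (filter (\<lambda>i. i \<noteq> i0 \<and> Q i) [0..<N]))) = (\<Sum>i<N. h (B i)) + r"
proof -
  have "sum_list (map (h \<circ> B) (filter (\<lambda>i. i \<noteq> i0 \<and> Q i) [0..<N]))
      = sum (h \<circ> B) (set (filter (\<lambda>i. i \<noteq> i0 \<and> Q i) [0..<N]))"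
    by (rule sum_list_distinct_conv_sum_set) simp
  also have "\<dots> = sum (h \<circ> B) ({..<N} - {i0})"
    using assms(3) by (intro sum.mono_neutral_left) auto
  finally have "sum_list (map h (c0 # map B (filter (\<lambda>i. i \<noteq> i0 \<and> Q i) [0..<N])))
      = (h (B i0) + sum (h \<circ> B) ({..<N} - {i0})) + r"
    using assms(2) by (simp add: comp_def add_ac)
  also have "h (B i0) + sum (h \<circ> B) ({..<N} - {i0}) = (\<Sum>i<N. h (B i))"
    using assms(1) by (subst sum.remove[of "{..<N}" i0]) auto
  finally show ?thesis .
qed

locale continuous_vector_measure = finite_measure M for M :: "'w measure" +
  fixes G :: "'w set \<Rightarrow> 'y::banach"
  assumes vm: "vector_measure M G" and mc: "measure_continuous M G" and bv: "bounded_variation M G"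
begin

lemma G_empty [simp]: "G {} = 0"
proof -
  have "(\<lambda>n. G {}) sums G (\<Union>n::nat. {})"
    using vm[unfolded vector_measure_def, rule_format, of "\<lambda>_. {}"] by (simp add: disjoint_family_on_def)
  then have "(\<lambda>n::nat. G {}) \<longlonglongrightarrow> 0" by (intro summable_LIMSEQ_zero sums_summable)
  then show ?thesis by (simp add: LIMSEQ_const_iff)
qed

lemma G_Un: "A \<in> sets M \<Longrightarrow> B \<in> sets M \<Longrightarrow> A \<inter> B = {} \<Longrightarrow> G (A \<union> B) = G A + G B"
proof -
  assume *: "A \<in> sets M" "B \<in> sets M" "A \<inter> B = {}"
  have "(\<lambda>n. G (binaryset A B n)) sums G (\<Union>n. binaryset A B n)"
  proof (rule vm[unfolded vector_measure_def, rule_format])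
    show "range (binaryset A B) \<subseteq> sets M" using * by (simp add: range_binaryset_eq)
    show "disjoint_family (binaryset A B)"
      using *(3) by (auto simp: disjoint_family_on_def binaryset_def)
  qed
  moreover have "(\<lambda>n. G (binaryset A B n)) sums (G A + G B)"
    by (rule binaryset_sums) simp
  ultimately show ?thesis by (simp add: UN_binaryset_eq sums_unique2)
qed

lemma G_Diff: "A \<in> sets M \<Longrightarrow> B \<in> sets M \<Longrightarrow> B \<subseteq> A \<Longrightarrow> G (A - B) = G A - G B"
  using G_Un[of "A - B" B] by (simp add: Un_absorb2 Int_commute algebra_simps)

lemma G_null: "E \<in> sets M \<Longrightarrow> measure M E = 0 \<Longrightarrow> G E = 0"
proof (rule ccontr)
  assume "E \<in> sets M" "measure M E = 0" "G E \<noteq> 0"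
  then show False
    using mc[unfolded measure_continuous_def, rule_format, of "norm (G E)"] by force
qed

lemma G_finite_UN:
  assumes "range B \<subseteq> sets M" "disjoint_family B"
  shows "G (\<Union>i<n::nat. B i) = (\<Sum>i<n. G (B i))"
proof (induction n)
  case (Suc n)
  have "B i \<inter> B n = {}" if "i < n" for i
    using disjoint_family_onD[OF assms(2), of i n] that by simp
  then have disj: "(\<Union>i<n. B i) \<inter> B n = {}" by blast
  have UN: "(\<Union>i<Suc n. B i) = (\<Union>i<n. B i) \<union> B n" by (auto simp: less_Suc_eq)
  have "G (\<Union>i<Suc n. B i) = G (\<Union>i<n. B i) + G (B n)"
    unfolding UN using assms(1) by (intro G_Un disj) auto
  then show ?case using Suc by simp
qed simp

lemma G_split:
  assumes "E \<in> sets M" "range B \<subseteq> sets M" "disjoint_family B" "\<And>i. B i \<subseteq> E"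
  shows "G E = (\<Sum>i<n::nat. G (B i)) + G (E - (\<Union>i<n. B i))"
    and "measure M E = (\<Sum>i<n. measure M (B i)) + measure M (E - (\<Union>i<n. B i))"
proof -
  have *: "(\<Union>i<n. B i) \<in> sets M" "(\<Union>i<n. B i) \<subseteq> E" using assms by auto
  show "G E = (\<Sum>i<n. G (B i)) + G (E - (\<Union>i<n. B i))"
    using G_Diff[OF assms(1) *] G_finite_UN[OF assms(2,3)] by simp
  have "measure M (\<Union>i<n. B i) = (\<Sum>i<n. measure M (B i))"
    using assms by (intro finite_measure_finite_Union) (auto simp: disjoint_family_on_def)
  then show "measure M E = (\<Sum>i<n. measure M (B i)) + measure M (E - (\<Union>i<n. B i))"
    using finite_measure_Diff[OF assms(1) *] by simp
qed

text \<open>Bounded variation speaks of partitions of the whole space, so the complement of the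
  pieces is added. Empty pieces are dropped to make the indexing injective, as the variation is a
  sum over a set of sets.\<close>

lemma variation_bound:
  "\<exists>V\<ge>0. \<forall>B n. range B \<subseteq> sets M \<longrightarrow> disjoint_family B \<longrightarrow> (\<Sum>i<n::nat. norm (G (B i))) \<le> V"
proof -
  obtain V where V: "\<forall>P. finite P \<and> P \<subseteq> sets M \<and> disjoint P \<and> \<Union>P = space M \<longrightarrow> (\<Sum>E\<in>P. norm (G E)) \<le> V"
    using bv unfolding bounded_variation_def by (rule exE)
  have le: "(\<Sum>i<n. norm (G (B i))) \<le> V" if B: "range B \<subseteq> sets M" "disjoint_family B" for B and n :: nat
  proof -
    define I where "I = {i. i < n \<and> B i \<noteq> {}}"
    define P where "P = insert (space M - (\<Union>i<n. B i)) (B ` I)"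
    have sub: "B i \<subseteq> space M" for i using B(1) sets.sets_into_space by blast
    have inj: "inj_on B I"
      using B(2) unfolding inj_on_def I_def disjoint_family_on_def by blast
    have "(\<Sum>i<n. norm (G (B i))) = (\<Sum>i\<in>I. norm (G (B i)))"
      by (rule sum.mono_neutral_right) (auto simp: I_def)
    also have "\<dots> = (\<Sum>E\<in>B ` I. norm (G E))" using inj by (simp add: sum.reindex)
    also have "\<dots> \<le> (\<Sum>E\<in>P. norm (G E))"
      by (rule sum_mono2) (auto simp: P_def I_def)
    also have "\<dots> \<le> V"
    proof (intro V[rule_format] conjI)
      show "finite P" by (simp add: P_def I_def)
      show "P \<subseteq> sets M" using B(1) by (auto simp: P_def)
      show "\<Union>P = space M" using sub by (auto simp: P_def I_def)
      have "disjoint (B ` I)"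
        using B(2) by (intro disjoint_family_on_disjoint_image) (auto simp: disjoint_family_on_def)
      then show "disjoint P"
        by (auto simp: P_def I_def pairwise_insert disjnt_def)
    qed
    finally show ?thesis .
  qed
  have "0 \<le> V" using le[of "\<lambda>_. {}" 0] by (simp add: disjoint_family_on_def)
  then show ?thesis using le by blast
qed

text \<open>Otherwise pieces with \<open>norm (G B) \<ge> k * measure M B\<close> would exhaust
  \<open>A\<close> for every \<open>k\<close>, and with \<open>k * measure M A = V + 1\<close> their
  variation would exceed the bound \<open>V\<close>. The \<open>k\<close> obtained here becomes the
  Lipschitz constant of the curve.\<close>

lemma locally_bounded:
  assumes A: "A \<in> sets M" "0 < measure M A"
  shows "\<exists>A'\<in>sets M. A' \<subseteq> A \<and> 0 < measure M A' \<and>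
    (\<exists>k\<ge>0. \<forall>E\<in>sets M. E \<subseteq> A' \<longrightarrow> norm (G E) \<le> k * measure M E)"
proof (rule ccontr)
  assume neg: "\<not> ?thesis"
  obtain V where V: "V \<ge> 0" "\<And>B n. range B \<subseteq> sets M \<Longrightarrow> disjoint_family B \<Longrightarrow> (\<Sum>i<n::nat. norm (G (B i))) \<le> V"
    using variation_bound by blast
  define k where "k = (V + 1) / measure M A"
  have k: "k \<ge> 0" "k * measure M A = V + 1" using V(1) A(2) by (auto simp: k_def)
  have ex: "\<exists>B\<in>sets M. B \<subseteq> R \<and> k * measure M B \<le> norm (G B) \<and> 0 < measure M B"
    if R: "R \<in> sets M" "R \<subseteq> A" "0 < measure M R" for R
  proof -
    obtain E where E: "E \<in> sets M" "E \<subseteq> R" "k * measure M E < norm (G E)"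
      using neg R k(1) by (meson not_le)
    then have "measure M E \<noteq> 0" using G_null[of E] by auto
    then show ?thesis using E by (intro bexI[of _ E]) (auto simp: zero_less_measure_iff)
  qed
  have "k * measure M {} \<le> norm (G {})" by simp
  note exh = exhaustion[OF A(1), of "\<lambda>B. k * measure M B \<le> norm (G B)", OF this ex]
  obtain B :: "nat \<Rightarrow> 'w set" where B: "range B \<subseteq> sets M" "disjoint_family B" "\<And>i. k * measure M (B i) \<le> norm (G (B i))"
    "\<And>i. B i \<subseteq> A" "measure M (A - (\<Union>i. B i)) = 0"
    using exh by blast
  have "k * (measure M A - measure M (A - (\<Union>i<n. B i))) \<le> V" for n
  proof -
    have "k * (measure M A - measure M (A - (\<Union>i<n. B i))) = (\<Sum>i<n. k * measure M (B i))"
      unfolding G_split(2)[OF A(1) B(1,2,4), of n] by (simp add: sum_distrib_left)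
    also have "\<dots> \<le> (\<Sum>i<n. norm (G (B i)))" by (intro sum_mono B(3))
    also have "\<dots> \<le> V" by (rule V(2)[OF B(1,2)])
    finally show ?thesis .
  qed
  moreover have "(\<lambda>n. k * (measure M A - measure M (A - (\<Union>i<n. B i)))) \<longlonglongrightarrow> k * (measure M A - 0)"
    by (intro tendsto_intros remainder_LIMSEQ A B)
  ultimately have "k * (measure M A - 0) \<le> V" by (intro Lim_bounded[where M = 0]) auto
  then show False using k(2) by simp
qed

text \<open>In terms of averages: those over subsets of \<open>B\<close> of positive measure lie in
  a ball of radius \<open>\<epsilon>\<close> about \<open>y\<close>, so \<open>y\<close> acts as an
  approximate density on \<open>B\<close>.\<close>

definition flat :: "real \<Rightarrow> 'w set \<Rightarrow> bool" where
  "flat \<epsilon> B \<longleftrightarrow> (\<exists>y. \<forall>E\<in>sets M. E \<subseteq> B \<longrightarrow> norm (G E - measure M E *\<^sub>R y) \<le> \<epsilon> * measure M E)"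

section \<open>Bushes in sets without flat parts\<close>

context
  fixes A :: "'w set" and k \<epsilon> :: real and T
  assumes A: "A \<in> sets M" and k: "0 \<le> k" "\<And>E. E \<in> sets M \<Longrightarrow> E \<subseteq> A \<Longrightarrow> norm (G E) \<le> k * measure M E"
    and \<epsilon>: "0 < \<epsilon>" and not_flat: "\<And>B. B \<in> sets M \<Longrightarrow> B \<subseteq> A \<Longrightarrow> 0 < measure M B \<Longrightarrow> \<not> flat \<epsilon> B"
  defines "T \<equiv> {E \<in> sets M. E \<subseteq> A \<and> 0 < measure M E}"
begin

lemma far_subset:
  assumes "R \<in> T"
  shows "\<exists>E\<in>T. E \<subseteq> R \<and> \<epsilon> * measure M E < norm (G E - measure M E *\<^sub>R y)"
proof -
  have "\<not> flat \<epsilon> R" using not_flat[of R] assms unfolding T_def by blast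
  then have "\<not> (\<forall>E\<in>sets M. E \<subseteq> R \<longrightarrow> norm (G E - measure M E *\<^sub>R y) \<le> \<epsilon> * measure M E)"
    unfolding flat_def by blast
  then obtain E where E: "E \<in> sets M" "E \<subseteq> R" "\<epsilon> * measure M E < norm (G E - measure M E *\<^sub>R y)"
    unfolding not_le[symmetric] by blast
  then have "measure M E \<noteq> 0" using G_null[of E] by auto
  then show ?thesis using E assms by (intro bexI[of _ E]) (auto simp: T_def zero_less_measure_iff)
qed

text \<open>Keeps the children below \<open>3/4\<close> of the measure of the parent, so that the intervals shrink uniformly.\<close>

lemma half_subset:
  assumes R: "R \<in> T"
  shows "\<exists>E\<in>T. E \<subseteq> R \<and> measure M E \<le> measure M R / 2"
proof -
  obtain E where E: "E \<in> T" "E \<subseteq> R" "\<epsilon> * measure M E < norm (G E - measure M E *\<^sub>R (G R /\<^sub>R measure M R))"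
    using far_subset[OF R] by blast
  have sets: "E \<in> sets M" "R \<in> sets M" "0 < measure M R" using E R by (auto simp: T_def)
  have diff: "measure M (R - E) = measure M R - measure M E" "G (R - E) = G R - G E"
    using finite_measure_Diff[of R E] G_Diff[of R E] sets E(2) by auto
  \<comment> \<open>If \<open>R - E\<close> were null, \<open>E\<close> and \<open>R\<close> would
    have the same average, against the choice of \<open>E\<close>. Thus there are no atoms, and one
    of \<open>E\<close> and \<open>R - E\<close> has at most half the measure.\<close>
  have "measure M (R - E) \<noteq> 0"
  proof
    assume 0: "measure M (R - E) = 0"
    then have "G (R - E) = 0" using G_null[of "R - E"] sets by auto
    then have "G E = G R" "measure M E = measure M R" using diff 0 by auto
    then show False using E(3) sets \<epsilon> by (simp add: mult_less_0_iff)
  qed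
  then have "R - E \<in> T" using R E by (auto simp: T_def zero_less_measure_iff)
  then show ?thesis
    using E(1,2) diff(1)
    by (cases "measure M E \<le> measure M R / 2") (blast, intro bexI[of _ "R - E"], auto)
qed

lemma children:
  assumes E: "E \<in> T"
  shows "\<exists>cs. set cs \<subseteq> T \<and> sum_list (map (measure M) cs) = measure M E \<and> sum_list (map G cs) = G E \<and>
    (\<forall>c\<in>set cs. measure M c \<le> 3 / 4 * measure M E \<and> \<epsilon> / 2 \<le> norm (G c /\<^sub>R measure M c - G E /\<^sub>R measure M E))"
proof -
  define y where "y = G E /\<^sub>R measure M E"
  \<comment> \<open>Both demands are stricter than those on children: the gaps from
    \<open>\<epsilon>\<close> to \<open>\<epsilon> / 2\<close> and from 1/2 to 3/4 are spent on the
    remainder.\<close>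
  define P where "P B \<longleftrightarrow> \<epsilon> * measure M B \<le> norm (G B - measure M B *\<^sub>R y) \<and> measure M B \<le> measure M E / 2" for B
  have Es: "E \<in> sets M" "E \<subseteq> A" "0 < measure M E" using E by (auto simp: T_def)
  have y: "norm y \<le> k"
    using k(2)[OF Es(1,2)] Es(3) by (simp add: y_def field_simps)
  have "P {}" by (simp add: P_def)
  have ex: "\<exists>B\<in>sets M. B \<subseteq> R \<and> P B \<and> 0 < measure M B"
    if R: "R \<in> sets M" "R \<subseteq> E" "0 < measure M R" for R
  proof -
    have "R \<in> T" using R Es by (auto simp: T_def)
    then obtain R' where R': "R' \<in> T" "R' \<subseteq> R" "measure M R' \<le> measure M R / 2" using half_subset by blast
    then obtain B where B: "B \<in> T" "B \<subseteq> R'" "\<epsilon> * measure M B < norm (G B - measure M B *\<^sub>R y)"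
      using far_subset by blast
    have "measure M B \<le> measure M R'" "measure M R \<le> measure M E"
      using B R' R Es by (auto intro!: finite_measure_mono simp: T_def)
    then have "P B" using B(3) R'(3) by (simp add: P_def)
    then show ?thesis using B R' by (intro bexI[of _ B]) (auto simp: T_def)
  qed
  note exh = exhaustion[OF Es(1), of P, OF \<open>P {}\<close> ex]
  obtain B :: "nat \<Rightarrow> 'w set" where B: "range B \<subseteq> sets M" "disjoint_family B" "\<And>i. P (B i)" "\<And>i. B i \<subseteq> E"
    "measure M (E - (\<Union>i. B i)) = 0"
    using exh by blast
  note rest = remainder_LIMSEQ[OF Es(1) B(1,5)]
  have "\<exists>i. measure M (B i) \<noteq> 0"
  proof (rule ccontr)
    assume "\<not> ?thesis"
    then have "measure M (E - (\<Union>i<n. B i)) = measure M E" for n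
      using G_split(2)[OF Es(1) B(1,2,4), of n] by simp
    then show False using rest Es(3) by (simp add: LIMSEQ_const_iff)
  qed
  then obtain i0 where i0: "0 < measure M (B i0)" by (auto simp: zero_less_measure_iff)
  \<comment> \<open>A quarter of the measure fills the gap from 1/2 to 3/4. The other term solves
    \<open>\<epsilon> * b - 2 * k * r \<ge> \<epsilon> / 2 * (b + r)\<close> for \<open>r\<close>,
    where \<open>b\<close> is the measure of \<open>B i0\<close> and \<open>2 * k * r\<close> bounds
    the effect of a remainder of measure \<open>r\<close>.\<close>
  define \<delta> where "\<delta> = min (measure M E / 4) (\<epsilon> / 2 * measure M (B i0) / (2 * k + \<epsilon> / 2))"
  have "\<delta> > 0" using Es i0 \<epsilon> k(1) by (simp add: \<delta>_def add_nonneg_pos)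
  then have "\<forall>\<^sub>F n in sequentially. measure M (E - (\<Union>i<n. B i)) < \<delta> \<and> i0 < n"
    using order_tendstoD(2)[OF rest] eventually_gt_at_top by (intro eventually_conj) auto
  then obtain N where N: "measure M (E - (\<Union>i<N. B i)) < \<delta>" "i0 < N"
    unfolding eventually_sequentially by blast
  \<comment> \<open>Finitely many pieces leave a remainder of small measure; absorbing it into one piece
    costs at most half of the distance between the averages.\<close>
  define R where "R = E - (\<Union>i<N. B i)"
  define cs where "cs = (B i0 \<union> R) # map B (filter (\<lambda>i. i \<noteq> i0 \<and> 0 < measure M (B i)) [0..<N])"
  have Bs: "B i \<in> sets M" for i using B(1) by auto
  have Rs: "R \<in> sets M" "B i0 \<inter> R = {}" "R \<subseteq> E" using Es Bs N by (auto simp: R_def)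
  have c0: "measure M (B i0 \<union> R) = measure M (B i0) + measure M R" "G (B i0 \<union> R) = G (B i0) + G R"
    using finite_measure_Union[OF Bs Rs(1,2)] G_Un[OF Bs Rs(1,2)] by auto
  have R\<delta>: "measure M R \<le> measure M E / 4" "(2 * k + \<epsilon> / 2) * measure M R \<le> \<epsilon> / 2 * measure M (B i0)"
    using N(1) k(1) \<epsilon> unfolding R_def[symmetric] \<delta>_def by (auto simp: field_simps)
  have "set cs \<subseteq> T"
    using i0 c0 Bs B(4) Rs Es by (fastforce simp: cs_def T_def intro: add_pos_nonneg)
  moreover have "sum_list (map (measure M) cs) = measure M E"
    unfolding cs_def G_split(2)[OF Es(1) B(1,2,4), of N] R_def[symmetric]
    using N(2) c0 by (intro sum_list_absorb) (auto simp: zero_less_measure_iff)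
  moreover have "sum_list (map G cs) = G E"
    unfolding cs_def G_split(1)[OF Es(1) B(1,2,4), of N] R_def[symmetric]
    using N(2) c0 by (intro sum_list_absorb) (auto simp: zero_less_measure_iff intro: G_null[OF Bs])
  moreover have est: "measure M c \<le> 3 / 4 * measure M E \<and> \<epsilon> / 2 * measure M c \<le> norm (G c - measure M c *\<^sub>R y)"
    if c: "c \<in> set cs" for c
  proof (cases "c = B i0 \<union> R")
    case True
    have "norm (G (B i0) - measure M (B i0) *\<^sub>R y)
        \<le> norm (G c - measure M c *\<^sub>R y) + norm (G R - measure M R *\<^sub>R y)"
      using norm_triangle_ineq4[of "G c - measure M c *\<^sub>R y" "G R - measure M R *\<^sub>R y"]
      unfolding True c0 by (simp add: algebra_simps)
    moreover have "norm (G R - measure M R *\<^sub>R y) \<le> k * measure M R + measure M R * k"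
    proof (rule order_trans[OF norm_triangle_ineq4 add_mono])
      show "norm (G R) \<le> k * measure M R" using Rs Es by (intro k(2)) auto
      show "norm (measure M R *\<^sub>R y) \<le> measure M R * k" using y by (simp add: mult_left_mono)
    qed
    moreover have "\<epsilon> * measure M (B i0) \<le> norm (G (B i0) - measure M (B i0) *\<^sub>R y)" "measure M (B i0) \<le> measure M E / 2"
      using B(3)[of i0] by (auto simp: P_def)
    ultimately show ?thesis using R\<delta> unfolding True c0(1) by (simp add: algebra_simps)
  next
    case False
    then obtain i where "c = B i"
      using c by (auto simp: cs_def)
    moreover have "\<epsilon> / 2 * measure M c \<le> \<epsilon> * measure M c" using \<epsilon> by (intro mult_right_mono) auto
    ultimately show ?thesis using B(3)[of i] Es(3) by (auto simp: P_def)
  qed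
  moreover have "\<epsilon> / 2 \<le> norm (G c /\<^sub>R measure M c - y)" if c: "c \<in> set cs" for c
  proof -
    have pos: "0 < measure M c" using c \<open>set cs \<subseteq> T\<close> by (auto simp: T_def)
    then have "G c - measure M c *\<^sub>R y = measure M c *\<^sub>R (G c /\<^sub>R measure M c - y)"
      by (simp add: scaleR_diff_right)
    then have "measure M c * (\<epsilon> / 2) \<le> measure M c * norm (G c /\<^sub>R measure M c - y)"
      using est[OF c] by (simp add: mult.commute)
    then show ?thesis using pos by (subst (asm) mult_le_cancel_left_pos)
  qed
  ultimately show ?thesis
    unfolding y_def[symmetric] by blast
qed

lemma bush_exists: "\<exists>ch. bush T (measure M) G ch k (\<epsilon> / 2)"
proof -
  obtain ch where "\<And>E. E \<in> T \<Longrightarrow> set (ch E) \<subseteq> T \<and> sum_list (map (measure M) (ch E)) = measure M E \<and>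
    sum_list (map G (ch E)) = G E \<and>
    (\<forall>c\<in>set (ch E). measure M c \<le> 3 / 4 * measure M E \<and> \<epsilon> / 2 \<le> norm (G c /\<^sub>R measure M c - G E /\<^sub>R measure M E))"
    using children by metis
  then have "bush T (measure M) G ch k (\<epsilon> / 2)"
    using k by unfold_locales (auto simp: T_def)
  then show ?thesis by blast
qed

end

end

section \<open>Densities from partitions into flat sets\<close>

lemma (in finite_measure) simple_bochner_sum:
  fixes y :: "'i \<Rightarrow> 'b::real_normed_vector"
  assumes "finite I" "\<And>i. C i \<in> sets M"
  shows "Bochner_Integration.simple_bochner_integrable M (\<lambda>x. \<Sum>i\<in>I. indicator (C i) x *\<^sub>R y i)"
    and "Bochner_Integration.simple_bochner_integral M (\<lambda>x. \<Sum>i\<in>I. indicator (C i) x *\<^sub>R y i) = (\<Sum>i\<in>I. measure M (C i) *\<^sub>R y i)"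
  using assms(1)
proof (induction I)
  case empty
  show 1: "Bochner_Integration.simple_bochner_integrable M (\<lambda>x. \<Sum>i\<in>{}. indicator (C i) x *\<^sub>R y i)"
    by (rule Bochner_Integration.simple_bochner_integrable.intros) auto
  show "Bochner_Integration.simple_bochner_integral M (\<lambda>x. \<Sum>i\<in>{}. indicator (C i) x *\<^sub>R y i) = (\<Sum>i\<in>{}. measure M (C i) *\<^sub>R y i)"
    by (auto simp: Bochner_Integration.simple_bochner_integral_def intro!: sum.neutral)
next
  case (insert j I)
  have ind: "Bochner_Integration.simple_bochner_integrable M (indicator (C j) :: 'a \<Rightarrow> real)"
    using assms(2) by (intro Bochner_Integration.simple_bochner_integrable.intros) auto
  have tm: "Bochner_Integration.simple_bochner_integrable M (\<lambda>x. indicator (C j) x *\<^sub>R y j)"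
    using assms(2)
    by (intro Bochner_Integration.simple_bochner_integrable.intros
        simple_function_compose1[of M "indicator (C j)" "\<lambda>c. c *\<^sub>R y j"]) auto
  have "linear (\<lambda>c. c *\<^sub>R y j)" by (intro linearI) (auto simp: scaleR_add_left)
  from simple_bochner_integral_linear[OF this ind]
  have val: "Bochner_Integration.simple_bochner_integral M (\<lambda>x. indicator (C j) x *\<^sub>R y j) = measure M (C j) *\<^sub>R y j"
    using simple_bochner_integrable_eq_integral[OF ind] assms(2)[of j] sets.sets_into_space[of "C j"]
    by (simp add: Int_absorb2)
  show "Bochner_Integration.simple_bochner_integrable M (\<lambda>x. \<Sum>i\<in>insert j I. indicator (C i) x *\<^sub>R y i)"
    unfolding sum.insert[OF insert.hyps]
    by (rule simple_bochner_integrable_compose2[of "(+)", OF _ tm insert.IH(1)]) simp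
  show "Bochner_Integration.simple_bochner_integral M (\<lambda>x. \<Sum>i\<in>insert j I. indicator (C i) x *\<^sub>R y i)
      = (\<Sum>i\<in>insert j I. measure M (C i) *\<^sub>R y i)"
    unfolding sum.insert[OF insert.hyps] simple_bochner_integral_add[OF tm insert.IH(1)] val insert.IH(2) ..
qed

context continuous_vector_measure
begin

text \<open>Cutting the partition at \<open>k\<close> makes the approximate density a simple
  function. The tail is small in the mean: bounded variation makes the norms of
  \<open>G (B i)\<close> summable, and \<open>measure M (B i) * norm (y i)\<close> exceeds them by
  at most \<open>\<epsilon> * measure M (B i)\<close>.\<close>

lemma flat_partition:
  assumes ex: "\<And>A. A \<in> sets M \<Longrightarrow> 0 < measure M A \<Longrightarrow> \<exists>B\<in>sets M. B \<subseteq> A \<and> 0 < measure M B \<and> flat \<epsilon> B"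
    and "0 < \<epsilon>"
  shows "\<exists>B y k. range B \<subseteq> sets M \<and> disjoint_family B \<and> measure M (space M - (\<Union>i::nat. B i)) = 0 \<and>
    (\<forall>i. \<forall>E\<in>sets M. E \<subseteq> B i \<longrightarrow> norm (G E - measure M E *\<^sub>R y i) \<le> \<epsilon> * measure M E) \<and>
    measure M (space M - (\<Union>i<k. B i)) < \<epsilon> \<and>
    (\<Sum>i. ennreal (measure M (B (i + k)) * norm (y (i + k)))) \<le> ennreal (\<epsilon> * (1 + measure M (space M)))"
proof -
  have "flat \<epsilon> {}" unfolding flat_def by simp
  have "\<exists>B\<in>sets M. B \<subseteq> R \<and> flat \<epsilon> B \<and> 0 < measure M B" if "R \<in> sets M" "R \<subseteq> space M" "0 < measure M R" for R
    using ex[OF that(1,3)] by blast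
  from exhaustion[OF sets.top, of "flat \<epsilon>", OF \<open>flat \<epsilon> {}\<close> this]
  obtain B :: "nat \<Rightarrow> 'w set" where B: "range B \<subseteq> sets M" "disjoint_family B" "\<And>i. flat \<epsilon> (B i)"
    "measure M (space M - (\<Union>i. B i)) = 0"
    by blast
  have "\<exists>y. \<forall>i. \<forall>E\<in>sets M. E \<subseteq> B i \<longrightarrow> norm (G E - measure M E *\<^sub>R y i) \<le> \<epsilon> * measure M E"
    using B(3) unfolding flat_def by (intro choice) blast
  then obtain y where y: "\<And>i E. E \<in> sets M \<Longrightarrow> E \<subseteq> B i \<Longrightarrow> norm (G E - measure M E *\<^sub>R y i) \<le> \<epsilon> * measure M E"
    by blast
  obtain V where "\<And>n. (\<Sum>i<n. norm (G (B i))) \<le> V"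
    using variation_bound B(1,2) by blast
  then have sG: "summable (\<lambda>i. norm (G (B i)))"
    by (intro summableI_nonneg_bounded[of _ V]) auto
  have sM: "summable (\<lambda>i. measure M (B i))" "(\<Sum>i. measure M (B i)) \<le> measure M (space M)"
    using finite_measure_UNION[OF B(1,2)] bounded_measure by (auto simp: sums_iff)
  obtain N where N: "\<And>n. n \<ge> N \<Longrightarrow> norm (\<Sum>i. norm (G (B (i + n)))) < \<epsilon>"
    using suminf_exist_split[OF \<open>0 < \<epsilon>\<close> sG] by blast
  have "\<forall>\<^sub>F k in sequentially. measure M (space M - (\<Union>i<k. B i)) < \<epsilon> \<and> N \<le> k"
    using order_tendstoD(2)[OF remainder_LIMSEQ[OF sets.top B(1,4)] \<open>0 < \<epsilon>\<close>] eventually_ge_at_top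
    by (rule eventually_conj)
  then obtain k where k: "measure M (space M - (\<Union>i<k. B i)) < \<epsilon>" "N \<le> k"
    unfolding eventually_sequentially by blast
  have Bs: "B i \<in> sets M" for i using B(1) by auto
  have sums: "summable (\<lambda>i. norm (G (B (i + k))))" "summable (\<lambda>i. measure M (B (i + k)))"
    "summable (\<lambda>i. \<epsilon> * measure M (B (i + k)))"
    using summable_ignore_initial_segment[OF sG] summable_ignore_initial_segment[OF sM(1)]
    by (auto intro: summable_mult)
  have "measure M (B i) * norm (y i) \<le> norm (G (B i)) + \<epsilon> * measure M (B i)" for i
    using y[OF Bs, of i i] norm_triangle_ineq2[of "measure M (B i) *\<^sub>R y i" "G (B i)"]
    by (simp add: norm_minus_commute)
  then have "(\<Sum>i. ennreal (measure M (B (i + k)) * norm (y (i + k))))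
      \<le> (\<Sum>i. ennreal (norm (G (B (i + k))) + \<epsilon> * measure M (B (i + k))))"
    by (intro suminf_le summableI ennreal_leI)
  also have "(\<Sum>i. ennreal (norm (G (B (i + k))) + \<epsilon> * measure M (B (i + k))))
      = ennreal ((\<Sum>i. norm (G (B (i + k)))) + (\<Sum>i. \<epsilon> * measure M (B (i + k))))"
    using \<open>0 < \<epsilon>\<close> sums by (subst suminf_ennreal2) (auto intro: summable_add simp: suminf_add)
  also have "\<dots> \<le> ennreal (\<epsilon> * (1 + measure M (space M)))"
  proof (rule ennreal_leI)
    have "(\<Sum>i. measure M (B (i + k))) \<le> (\<Sum>i. measure M (B i))"
      unfolding suminf_split_initial_segment[OF sM(1), of k] by (simp add: sum_nonneg)
    then have "\<epsilon> * (\<Sum>i. measure M (B (i + k))) \<le> \<epsilon> * measure M (space M)"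
      using sM(2) \<open>0 < \<epsilon>\<close> by (intro mult_left_mono) auto
    moreover have "(\<Sum>i. \<epsilon> * measure M (B (i + k))) = \<epsilon> * (\<Sum>i. measure M (B (i + k)))"
      using sums(2) by (rule suminf_mult)
    moreover have "(\<Sum>i. norm (G (B (i + k)))) \<le> \<epsilon>"
      using N[OF k(2)] by simp
    ultimately show "(\<Sum>i. norm (G (B (i + k)))) + (\<Sum>i. \<epsilon> * measure M (B (i + k))) \<le> \<epsilon> * (1 + measure M (space M))"
      by (simp add: distrib_left)
  qed
  finally show ?thesis
    using B y k(1) by blast
qed

text \<open>The partitions at different scales need not refine each other. Two cells that meet in
  positive measure have values close to the same average, that of \<open>G\<close> over the
  intersection, so the values at almost every point form a Cauchy sequence.\<close>

theorem density_exists: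
  assumes ex: "\<And>\<epsilon> A. 0 < \<epsilon> \<Longrightarrow> A \<in> sets M \<Longrightarrow> 0 < measure M A \<Longrightarrow> \<exists>B\<in>sets M. B \<subseteq> A \<and> 0 < measure M B \<and> flat \<epsilon> B"
  shows "\<exists>g. (\<exists>y. has_strong_bochner_integral M g y) \<and>
    (\<forall>E\<in>sets M. has_strong_bochner_integral M (\<lambda>x. indicator E x *\<^sub>R g x) (G E))"
proof -
  \<comment> \<open>Summability of the scales is needed for Borel-Cantelli.\<close>
  define e where "e n = (1/2::real) ^ n" for n
  have e: "e n > 0" "e \<longlonglongrightarrow> 0" "summable e" for n
    unfolding e_def[abs_def] by (auto intro!: LIMSEQ_realpow_zero summable_geometric)
  define Q where "Q n B y k \<longleftrightarrow> range B \<subseteq> sets M \<and> disjoint_family B \<and> measure M (space M - (\<Union>i::nat. B i)) = 0 \<and>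
    (\<forall>i. \<forall>E\<in>sets M. E \<subseteq> B i \<longrightarrow> norm (G E - measure M E *\<^sub>R y i) \<le> e n * measure M E) \<and>
    measure M (space M - (\<Union>i<k. B i)) < e n \<and>
    (\<Sum>i. ennreal (measure M (B (i + k)) * norm (y (i + k)))) \<le> ennreal (e n * (1 + measure M (space M)))"
    for n B y k
  have "\<forall>n. \<exists>B y k. Q n B y k"
    unfolding Q_def by (intro allI flat_partition ex e(1))
  then obtain B y k where Q: "\<And>n. Q n (B n) (y n) (k n)" by metis
  have B: "range (B n) \<subseteq> sets M" "disjoint_family (B n)" "measure M (space M - (\<Union>i. B n i)) = 0"
    and k: "measure M (space M - (\<Union>i<k n. B n i)) < e n"
    and tail: "(\<Sum>i. ennreal (measure M (B n (i + k n)) * norm (y n (i + k n)))) \<le> ennreal (e n * (1 + measure M (space M)))"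
    for n
    using Q[of n] unfolding Q_def by simp_all
  have y: "norm (G E - measure M E *\<^sub>R y n i) \<le> e n * measure M E" if "E \<in> sets M" "E \<subseteq> B n i" for n i E
    using Q[of n] that unfolding Q_def by simp
  have Bs [measurable]: "B n i \<in> sets M" for n i using B(1) by auto
  define s where "s n x = (\<Sum>i<k n. indicator (B n i) x *\<^sub>R y n i)" for n x
  define g where "g x = lim (\<lambda>n. s n x)" for x
  have s_val: "s n x = (if i < k n then y n i else 0)" if "x \<in> B n i" for n i x
  proof -
    have "indicator (B n j) x *\<^sub>R y n j = (if j = i then y n i else 0)" for j
      using that disjoint_family_onD[OF B(2)[of n], of i j] by (auto simp: indicator_def)
    then show ?thesis by (simp add: s_def)
  qed
  have "AE x in M. \<forall>n. x \<notin> space M - (\<Union>i. B n i)"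
    unfolding AE_all_countable using B(3)
    by (intro allI AE_not_in) (auto simp: null_sets_def emeasure_eq_measure)
  \<comment> \<open>Cells that meet in a null set give no comparison of their values; these
    countably many intersections are discarded together.\<close>
  moreover have "AE x in M. \<forall>n m i j. measure M (B n i \<inter> B m j) = 0 \<longrightarrow> x \<notin> B n i \<inter> B m j"
    unfolding AE_all_countable
  proof (intro allI)
    show "AE x in M. measure M (B n i \<inter> B m j) = 0 \<longrightarrow> x \<notin> B n i \<inter> B m j" for n m i j
    proof (cases "measure M (B n i \<inter> B m j) = 0")
      case True
      then have "B n i \<inter> B m j \<in> null_sets M" by (auto simp: null_sets_def emeasure_eq_measure)
      from AE_not_in[OF this] show ?thesis by eventually_elim auto
    qed simp
  qed
  \<comment> \<open>Almost every point lies in the first \<open>k n\<close> cells for all but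
    finitely many \<open>n\<close>, so the truncation does not change the limit.\<close>
  moreover have "AE x in M. \<forall>\<^sub>F n in sequentially. x \<in> space M - (space M - (\<Union>i<k n. B n i))"
  proof (rule borel_cantelli_AE1)
    show "summable (\<lambda>n. measure M (space M - (\<Union>i<k n. B n i)))"
      using k by (intro summable_comparison_test'[OF e(3), of 0]) (auto intro: less_imp_le)
  qed (auto simp: emeasure_eq_measure)
  \<comment> \<open>The right-hand side is a measurable majorant. It is integrated instead of
    \<open>norm (g x - s n x)\<close>, whose Borel measurability is not at hand; monotonicity of
    \<open>nn_integral\<close> does not ask for it.\<close>
  ultimately have good: "AE x in M. (\<lambda>n. s n x) \<longlonglongrightarrow> g x \<and>
    (\<forall>n. ennreal (norm (g x - s n x)) \<le> ennreal (e n) +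
      (\<Sum>i. ennreal (norm (y n (i + k n))) * indicator (B n (i + k n)) x))"
    using AE_space
  proof eventually_elim
    case (elim x)
    have "\<forall>n. \<exists>i. x \<in> B n i" using elim by blast
    then obtain \<iota> where \<iota>: "\<And>n. x \<in> B n (\<iota> n)" by metis
    define z where "z n = y n (\<iota> n)" for n
    have dist: "norm (z n - z m) \<le> e n + e m" for n m
    proof -
      define E where "E = B n (\<iota> n) \<inter> B m (\<iota> m)"
      have E: "E \<in> sets M" by (simp add: E_def)
      have "measure M E \<noteq> 0" using elim(2) \<iota> unfolding E_def by blast
      then have pos: "0 < measure M E" by (simp add: zero_less_measure_iff)
      have "measure M E * norm (z n - z m) = norm (measure M E *\<^sub>R z n - measure M E *\<^sub>R z m)"
        by (simp flip: scaleR_diff_right)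
      also have "\<dots> = norm ((G E - measure M E *\<^sub>R z m) - (G E - measure M E *\<^sub>R z n))" by simp
      also have "\<dots> \<le> e m * measure M E + e n * measure M E"
        unfolding z_def
        by (rule order_trans[OF norm_triangle_ineq4 add_mono]) (auto intro!: y E simp: E_def)
      finally have "measure M E * norm (z n - z m) \<le> measure M E * (e n + e m)" by (simp add: algebra_simps)
      then show ?thesis using pos by simp
    qed
    have "Cauchy z"
    proof (rule CauchyI)
      fix r :: real assume "r > 0"
      then have "\<forall>\<^sub>F n in sequentially. e n < r / 2" by (intro order_tendstoD(2)[OF e(2)]) simp
      then obtain N where N: "\<And>n. n \<ge> N \<Longrightarrow> e n < r / 2" unfolding eventually_sequentially by blast
      have "norm (z m - z n) < r" if "m \<ge> N" "n \<ge> N" for m n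
        using dist[of m n] N[OF that(1)] N[OF that(2)] by simp
      then show "\<exists>M. \<forall>m\<ge>M. \<forall>n\<ge>M. norm (z m - z n) < r" by blast
    qed
    then obtain l where l: "z \<longlonglongrightarrow> l" using Cauchy_convergent convergentD by blast
    have lz: "norm (l - z n) \<le> e n" for n
    proof (rule tendsto_le[OF trivial_limit_sequentially])
      show "(\<lambda>m. norm (z m - z n)) \<longlonglongrightarrow> norm (l - z n)" by (intro tendsto_intros l)
      show "(\<lambda>m. e m + e n) \<longlonglongrightarrow> e n" using tendsto_add[OF e(2) tendsto_const[of "e n"]] by simp
    qed (use dist in simp)
    have "\<forall>\<^sub>F n in sequentially. z n = s n x"
      using elim(3)
    proof eventually_elim
      case (elim n)
      then obtain i where "i < k n" "x \<in> B n i" by blast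
      moreover from this have "i = \<iota> n"
        using \<iota>[of n] disjoint_family_onD[OF B(2)[of n], of i "\<iota> n"] by blast
      ultimately show ?case using s_val by (simp add: z_def)
    qed
    with l have s_lim: "(\<lambda>n. s n x) \<longlonglongrightarrow> l" by (rule Lim_transform_eventually)
    then have "g x = l" unfolding g_def by (rule limI)
    have "ennreal (norm (l - s n x)) \<le> ennreal (e n) + (\<Sum>i. ennreal (norm (y n (i + k n))) * indicator (B n (i + k n)) x)" for n
    proof (cases "\<iota> n < k n")
      case True
      then have "ennreal (norm (l - s n x)) \<le> ennreal (e n)"
        using lz[of n] s_val[OF \<iota>[of n]] by (simp add: z_def ennreal_leI)
      then show ?thesis by (rule order_trans) simp
    next
      case False
      have "norm l \<le> e n + norm (z n)" using lz[of n] norm_triangle_ineq2[of l "z n"] by simp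
      then have "ennreal (norm (l - s n x)) \<le> ennreal (e n) + ennreal (norm (z n))"
        using s_val[OF \<iota>[of n]] False e(1)[of n] by (simp flip: ennreal_plus add: ennreal_leI)
      also have "ennreal (norm (z n)) \<le> (\<Sum>i. ennreal (norm (y n (i + k n))) * indicator (B n (i + k n)) x)"
      proof -
        have "(\<Sum>i\<in>{\<iota> n - k n}. ennreal (norm (y n (i + k n))) * indicator (B n (i + k n)) x)
            \<le> (\<Sum>i. ennreal (norm (y n (i + k n))) * indicator (B n (i + k n)) x)"
          by (intro sum_le_suminf summableI) auto
        then show ?thesis using False \<iota>[of n] by (simp add: z_def)
      qed
      finally show ?thesis by (simp add: add_left_mono)
    qed
    then show ?case using s_lim \<open>g x = l\<close> by simp
  qed
  define D where "D = 1 + 2 * measure M (space M)"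
  have int_bound: "(\<integral>\<^sup>+x. norm (g x - s n x) \<partial>M) \<le> ennreal (e n * D)" for n
  proof -
    have "(\<integral>\<^sup>+x. norm (g x - s n x) \<partial>M) \<le>
      (\<integral>\<^sup>+x. ennreal (e n) + (\<Sum>i. ennreal (norm (y n (i + k n))) * indicator (B n (i + k n)) x) \<partial>M)"
      using good by (intro nn_integral_mono_AE) (auto elim: eventually_mono)
    also have "\<dots> = ennreal (e n) * emeasure M (space M)
        + (\<Sum>i. ennreal (norm (y n (i + k n))) * emeasure M (B n (i + k n)))"
      by (subst nn_integral_add) (auto simp: nn_integral_suminf nn_integral_cmult_indicator)
    also have "\<dots> = ennreal (e n * measure M (space M))
        + (\<Sum>i. ennreal (measure M (B n (i + k n)) * norm (y n (i + k n))))"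
      using e(1)[of n] by (simp add: emeasure_eq_measure ennreal_mult'' mult.commute)
    also have "\<dots> \<le> ennreal (e n * measure M (space M)) + ennreal (e n * (1 + measure M (space M)))"
      using tail by (intro add_left_mono)
    also have "\<dots> = ennreal (e n * D)"
      using e(1)[of n] by (simp flip: ennreal_plus add: D_def algebra_simps)
    finally show ?thesis .
  qed
  have main: "has_strong_bochner_integral M (\<lambda>x. indicator E x *\<^sub>R g x) (G E)" if E [measurable]: "E \<in> sets M" for E
  proof -
    define sE where "sE n x = (\<Sum>i<k n. indicator (B n i \<inter> E) x *\<^sub>R y n i)" for n x
    have sE: "sE n x = indicator E x *\<^sub>R s n x" for n x
      by (auto simp: sE_def s_def indicator_def)
    have int: "Bochner_Integration.simple_bochner_integrable M (sE n)"
      "Bochner_Integration.simple_bochner_integral M (sE n) = (\<Sum>i<k n. measure M (B n i \<inter> E) *\<^sub>R y n i)" for n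
      unfolding sE_def[abs_def] by (intro simple_bochner_sum; simp)+
    have "strongly_measurable M (\<lambda>x. indicator E x *\<^sub>R g x)"
      unfolding strongly_measurable_def
    proof (intro exI[of _ sE] conjI allI)
      show "simple_function M (sE n)" for n
        using int(1)[of n] by (rule Bochner_Integration.simple_bochner_integrable.cases)
      show "AE x in M. (\<lambda>n. sE n x) \<longlonglongrightarrow> indicator E x *\<^sub>R g x"
        unfolding sE using good by eventually_elim (intro tendsto_intros, blast)
    qed
    moreover have "(\<lambda>n. \<integral>\<^sup>+x. norm (indicator E x *\<^sub>R g x - sE n x) \<partial>M) \<longlonglongrightarrow> 0"
    proof (rule tendsto_sandwich[OF _ _ tendsto_const])
      have "(\<integral>\<^sup>+x. norm (indicator E x *\<^sub>R g x - sE n x) \<partial>M) \<le> (\<integral>\<^sup>+x. norm (g x - s n x) \<partial>M)" for n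
        by (intro nn_integral_mono ennreal_leI) (auto simp: sE indicator_def)
      then show "\<forall>\<^sub>F n in sequentially. (\<integral>\<^sup>+x. norm (indicator E x *\<^sub>R g x - sE n x) \<partial>M) \<le> ennreal (e n * D)"
        using int_bound order_trans by (intro always_eventually) blast
      have "(\<lambda>n. ennreal (e n * D)) \<longlonglongrightarrow> ennreal (0 * D)" by (intro tendsto_intros e)
      then show "(\<lambda>n. ennreal (e n * D)) \<longlonglongrightarrow> 0" by simp
    qed simp
    moreover have "(\<lambda>n. Bochner_Integration.simple_bochner_integral M (sE n)) \<longlonglongrightarrow> G E"
    proof -
      \<comment> \<open>The part of \<open>E\<close> missed by the truncated partition:
        \<open>G (R n)\<close> tends to 0 by continuity with respect to the measure, and the rest of
        \<open>G E\<close> is matched cell by cell with total error at most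
        \<open>e n * measure M E\<close>.\<close>
      define R where "R n = E - (\<Union>i<k n. B n i \<inter> E)" for n
      have "(\<lambda>n. measure M (R n)) \<longlonglongrightarrow> 0"
      proof (rule tendsto_sandwich[OF _ _ tendsto_const e(2)])
        have "measure M (R n) \<le> measure M (space M - (\<Union>i<k n. B n i))" for n
          using sets.sets_into_space[OF E] by (intro finite_measure_mono) (auto simp: R_def)
        then show "\<forall>\<^sub>F n in sequentially. measure M (R n) \<le> e n"
          using k by (intro always_eventually allI) (meson less_imp_le order_trans)
      qed simp
      have "(\<lambda>n. G (R n)) \<longlonglongrightarrow> 0"
      proof (rule tendstoI)
        fix r :: real assume "r > 0"
        then obtain \<delta> where \<delta>: "\<delta> > 0" "\<And>E. E \<in> sets M \<Longrightarrow> measure M E < \<delta> \<Longrightarrow> norm (G E) < r"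
          using mc unfolding measure_continuous_def by blast
        have "R n \<in> sets M" for n by (simp add: R_def)
        moreover have "\<forall>\<^sub>F n in sequentially. measure M (R n) < \<delta>"
          using \<open>(\<lambda>n. measure M (R n)) \<longlonglongrightarrow> 0\<close> \<delta>(1) by (rule order_tendstoD)
        ultimately show "\<forall>\<^sub>F n in sequentially. dist (G (R n)) 0 < r"
          using \<delta>(2) by (auto elim: eventually_mono)
      qed
      moreover have "(\<lambda>n. G E - G (R n) - Bochner_Integration.simple_bochner_integral M (sE n)) \<longlonglongrightarrow> 0"
      proof (rule tendsto_norm_zero_cancel, rule tendsto_sandwich[OF _ _ tendsto_const])
        have bound: "norm (G E - G (R n) - Bochner_Integration.simple_bochner_integral M (sE n)) \<le> e n * measure M E" for n
        proof -
          have BE: "range (\<lambda>i. B n i \<inter> E) \<subseteq> sets M" "disjoint_family (\<lambda>i. B n i \<inter> E)" "\<And>i. B n i \<inter> E \<subseteq> E"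
            using B(2)[of n] by (auto simp: disjoint_family_on_def)
          have "G E - G (R n) - Bochner_Integration.simple_bochner_integral M (sE n)
              = (\<Sum>i<k n. G (B n i \<inter> E) - measure M (B n i \<inter> E) *\<^sub>R y n i)"
            unfolding int R_def using G_split(1)[OF E BE, of "k n"] by (simp add: sum_subtractf)
          also have "norm \<dots> \<le> (\<Sum>i<k n. e n * measure M (B n i \<inter> E))"
            by (intro sum_norm_le y) auto
          also have "\<dots> \<le> e n * measure M E"
            unfolding sum_distrib_left[symmetric] using G_split(2)[OF E BE, of "k n"] e(1)[of n]
            by (intro mult_left_mono) auto
          finally show ?thesis .
        qed
        then show "\<forall>\<^sub>F n in sequentially. norm (G E - G (R n) - Bochner_Integration.simple_bochner_integral M (sE n)) \<le> e n * measure M E"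
          by simp
        show "(\<lambda>n. e n * measure M E) \<longlonglongrightarrow> 0" using tendsto_mult_right[OF e(2), of "measure M E"] by simp
      qed simp
      ultimately have "(\<lambda>n. G E - (G (R n) + (G E - G (R n) - Bochner_Integration.simple_bochner_integral M (sE n)))) \<longlonglongrightarrow> G E - (0 + 0)"
        by (intro tendsto_intros)
      then show ?thesis by simp
    qed
    ultimately show ?thesis
      unfolding has_strong_bochner_integral_def using int(1) by blast
  qed
  \<comment> \<open>Outside \<open>space M\<close> every \<open>s n\<close> is 0, hence so is its
    limit \<open>g\<close>, and integrability of \<open>g\<close> is the case
    \<open>E = space M\<close>.\<close>
  have "indicator (space M) x *\<^sub>R g x = g x" for x
  proof (cases "x \<in> space M")
    case False
    then have "x \<notin> B n i" for n i using sets.sets_into_space[OF Bs] by blast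
    then have "s n x = 0" for n by (simp add: s_def)
    then show ?thesis by (simp add: g_def)
  qed simp
  then have "has_strong_bochner_integral M g (G (space M))"
    using main[OF sets.top] by simp
  then show ?thesis using main by blast
qed

end

theorem corollary2p16:
  assumes "(UNIV :: 'x::banach set) \<noteq> {0}"
    and "(UNIV :: 'y::banach set) \<noteq> {0}"
    and "\<And>N :: 'y \<Rightarrow> real. equivalent_norm N \<Longrightarrow>
           dense_in_Lip0 N (SNA N \<union> Der N :: ('x \<Rightarrow> 'y) set)"
  shows "radon_nikodym_property TYPE('w) TYPE('y)"
  unfolding radon_nikodym_property_def
proof (intro allI impI)
  fix M :: "'w measure" and G :: "'w set \<Rightarrow> 'y"
  assume *: "finite_measure M \<and> vector_measure M G \<and> measure_continuous M G \<and> bounded_variation M G"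
  then interpret finite_measure M by simp
  interpret continuous_vector_measure M G by unfold_locales (use * in auto)
  obtain e0 :: 'x where "e0 \<noteq> 0" using assms(1) by blast
  \<comment> \<open>The hypothesis of \<open>density_exists\<close>. Its failure on \<open>A\<close>
    is inherited by every part of positive measure, so one may pass to a part \<open>A'\<close> on
    which \<open>G\<close> is bounded by a multiple of the measure and grow the bush there.\<close>
  have "\<exists>B\<in>sets M. B \<subseteq> A \<and> 0 < measure M B \<and> flat \<epsilon> B"
    if "0 < \<epsilon>" and A: "A \<in> sets M" "0 < measure M A" for \<epsilon> A
  proof (rule ccontr)
    assume neg: "\<not> ?thesis"
    obtain A' k where A': "A' \<in> sets M" "A' \<subseteq> A" "0 < measure M A'"
      and k: "0 \<le> k" "\<And>E. E \<in> sets M \<Longrightarrow> E \<subseteq> A' \<Longrightarrow> norm (G E) \<le> k * measure M E"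
      using locally_bounded[OF A] by blast
    define T where "T = {E \<in> sets M. E \<subseteq> A' \<and> 0 < measure M E}"
    have "\<not> flat \<epsilon> B" if "B \<in> sets M" "B \<subseteq> A'" "0 < measure M B" for B
      using neg that A'(2) by blast
    from bush_exists[OF A'(1) k \<open>0 < \<epsilon>\<close> this] obtain ch where "bush T (measure M) G ch k (\<epsilon> / 2)"
      unfolding T_def by blast
    then interpret bush T "measure M" G ch k "\<epsilon> / 2" .
    have "A' \<in> T" using A' by (simp add: T_def)
    note F = oscillating_curve[OF this]
    have "\<epsilon> / 2 > 0" using \<open>0 < \<epsilon>\<close> by simp
    from oscillating_curve_not_dense[OF F(1) A'(3) F(2,3,4) this \<open>e0 \<noteq> 0\<close>] assms(3)
    show False by blast
  qed
  then show "\<exists>g. (\<exists>y. has_strong_bochner_integral M g y) \<and>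
    (\<forall>E\<in>sets M. has_strong_bochner_integral M (\<lambda>x. indicator E x *\<^sub>R g x) (G E))"
    by (rule density_exists)
qed

end
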